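(* Let $d\in\mathbb N$, $d\ge 1$, and put $\mathsf Q=4d+2$. Let $p\in[\frac{\mathsf Q}{\mathsf Q-1},\infty]$ and let $q\in[1,\infty]$ be defined by $\frac1q=\frac1p+\frac1{\mathsf Q}$. Then there exists a constant $C=C(d,p)>0$ such that for every $f\in\mathcal S(\mathbb R^{1+2d})\cap L^p(\mathbb R^{1+2d})$ with $\nabla_v f\in L^p(\mathbb R^{1+2d};\mathbb R^d)$ satisfying $$(\partial_t+v\cdot\nabla_x)f=\nabla_v\cdot S_0+S_1\quad\text{on }\mathbb R^{1+2d}$$ with $S_0\in\mathcal S(\mathbb R^{1+2d};\mathbb R^d)\cap L^p(\mathbb R^{1+2d};\mathbb R^d)$ and $S_1\in\mathcal S(\mathbb R^{1+2d})\cap L^q(\mathbb R^{1+2d})$, we have $$\sup_{h\in\mathbb R^d\setminus\{0\}}\frac{\|\Delta_x^h f\|_{L^p(\mathbb R^{1+2d})}}{|h|^{1/3}}\le C\bigl(\|S_0\|_{L^p(\mathbb R^{1+2d})}+\|\nabla_v f\|_{L^p(\mathbb R^{1+2d})}+\|S_1\|_{L^q(\mathbb R^{1+2d})}\bigr).$$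
   Context: Points of $\mathbb R^{1+2d}$ are written $(t,x,v)$ with $t\in\mathbb R$ and $x,v\in\mathbb R^d$; $\nabla_x,\nabla_v$ are the gradients in $x$ and $v$, and $\nabla_v\cdot$ is the divergence in $v$. $\mathcal S$ denotes the Schwartz class. For $h\in\mathbb R^d$, $[\Delta_x^h f](t,x,v)=f(t,x+h,v)-f(t,x,v)$. *)

theory Defs
  imports "HOL-Probability.Essential_Supremum"
begin

section \<open>Lebesgue norms\<close>

text \<open>
  The exponent ranges over the extended nonnegative reals.  The norm is itself extended-valued,
  so it is meaningful for every measurable function.  \<open>ennreal\<close> has no power with real exponent,
  hence the detour through \<^const>\<open>enn2real\<close> when the integral is finite.
\<close>

definition Lp_norm :: "ennreal \<Rightarrow> 'a measure \<Rightarrow> ('a \<Rightarrow> 'b::real_normed_vector) \<Rightarrow> ennreal" where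
  "Lp_norm p M f =
     (if p = \<infinity> then esssup M (\<lambda>z. ennreal (norm (f z)))
      else let I = (\<integral>\<^sup>+ z. ennreal (norm (f z) powr enn2real p) \<partial>M)
           in if I = \<infinity> then \<infinity> else ennreal (enn2real I powr (1 / enn2real p)))"

definition Lp_space :: "ennreal \<Rightarrow> 'a measure \<Rightarrow> ('a \<Rightarrow> 'b::real_normed_vector) set" where
  "Lp_space p M = {f \<in> borel_measurable M. Lp_norm p M f < \<infinity>}"


section \<open>Derivatives and the Schwartz class\<close>

definition dir_deriv ::
    "'a::real_normed_vector \<Rightarrow> ('a \<Rightarrow> 'b::real_normed_vector) \<Rightarrow> 'a \<Rightarrow> 'b" where
  "dir_deriv u f z = frechet_derivative f (at z) u"

text \<open>Lists of basis vectors play the role of multi-indices.\<close>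

primrec iter_deriv ::
    "'a::real_normed_vector list \<Rightarrow> ('a \<Rightarrow> 'b::real_normed_vector) \<Rightarrow> 'a \<Rightarrow> 'b" where
  "iter_deriv [] f = f"
| "iter_deriv (u # us) f = dir_deriv u (iter_deriv us f)"

text \<open>
  \<^const>\<open>frechet_derivative\<close> is unspecified where a function is not differentiable; the first
  conjunct demands that all iterated partial derivatives are differentiable everywhere, that is,
  that the function is infinitely differentiable.
\<close>

definition schwartz :: "('a::euclidean_space \<Rightarrow> 'b::real_normed_vector) set" where
  "schwartz =
     {f. (\<forall>us z. set us \<subseteq> Basis \<longrightarrow> iter_deriv us f differentiable (at z)) \<and>
         (\<forall>k us. set us \<subseteq> Basis \<longrightarrow>
            bounded (range (\<lambda>z. norm z ^ k *\<^sub>R iter_deriv us f z)))}"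


section \<open>Kinetic phase space\<close>

type_synonym 'n phase = "real \<times> (real ^ 'n) \<times> (real ^ 'n)"

definition deriv_t :: "('n::finite phase \<Rightarrow> real) \<Rightarrow> 'n phase \<Rightarrow> real" where
  "deriv_t f z = dir_deriv (1, 0, 0) f z"

definition grad_x :: "('n::finite phase \<Rightarrow> real) \<Rightarrow> 'n phase \<Rightarrow> real ^ 'n" where
  "grad_x f z = (\<chi> i. dir_deriv (0, axis i 1, 0) f z)"

definition grad_v :: "('n::finite phase \<Rightarrow> real) \<Rightarrow> 'n phase \<Rightarrow> real ^ 'n" where
  "grad_v f z = (\<chi> i. dir_deriv (0, 0, axis i 1) f z)"

definition div_v :: "('n::finite phase \<Rightarrow> real ^ 'n) \<Rightarrow> 'n phase \<Rightarrow> real" where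
  "div_v S z = (\<Sum>i\<in>UNIV. dir_deriv (0, 0, axis i 1) (\<lambda>w. S w $ i) z)"

definition diff_x :: "real ^ 'n \<Rightarrow> ('n::finite phase \<Rightarrow> real) \<Rightarrow> 'n phase \<Rightarrow> real" where
  "diff_x h f = (\<lambda>(t, x, v). f (t, x + h, v) - f (t, x, v))"

end

theory Submission
  imports Defs
begin

text \<open>
  The increment \<open>f (t, x + h, v) - f (t, x, v)\<close> is estimated by joining both points to a common
  endpoint with curves along which the equation controls \<open>f\<close>.  Write \<open>d\<close> for the dimension,
  \<open>Y = \<partial>\<^sub>t + v \<cdot> \<nabla>\<^sub>x\<close> and \<open>r = |h|\<^sup>1\<^sup>/\<^sup>3\<close>.  Along a curve with \<open>x' = t' v\<close> the chain rule gives
  \<open>t' Y f + v' \<cdot> \<nabla>\<^sub>v f\<close>, so only \<open>Y f = \<nabla>\<^sub>v \<cdot> S0 + S1\<close> and \<open>\<nabla>\<^sub>v f\<close> occur.  The curves \<open>traj\<close> start at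
  \<open>z\<close> for \<open>\<sigma> = 0\<close> and depend polynomially on \<open>\<sigma> \<in> [0, 1]\<close>; apart from the
  transport of \<open>x\<close> by the initial velocity, \<open>t\<close>, \<open>x\<close>, \<open>v\<close> move by distances of order \<open>r\<^sup>2\<close>, \<open>r\<^sup>3\<close>, \<open>r\<close>.  They carry a time parameter \<open>\<tau> \<in> [1, 2]\<close> and two velocity parameters
  \<open>c = (a, b)\<close>, which is enough for the point at a fixed \<open>\<sigma> > 0\<close> to range over an open set of
  \<open>\<real> \<times> \<real>\<^sup>d \<times> \<real>\<^sup>d\<close>.  A shift of \<open>a\<close> and \<open>b\<close> by multiples of \<open>h / r\<^sup>3\<close> makes the curve from
  \<open>(t, x + h, v)\<close> end where the curve from \<open>(t, x, v)\<close> ends (\<open>traj_meet\<close>).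

  Average over \<open>c\<close> with a \<open>C\<^sup>1\<close> weight supported in the unit ball.  For \<open>\<sigma> > 0\<close> there are directions
  in \<open>c\<close>-space that move only the velocity of the curve, hence the divergence of \<open>S0\<close> is a
  derivative in \<open>c\<close> and integration by parts puts it on the weight (\<open>integral_div_v_traj\<close>).  What is
  left is the pointwise bound \<open>norm_diff_x_le_traj_avg\<close>: the increment is at most a constant times
  \<open>r\<close> times averages of \<open>|S0|\<close>, \<open>|\<nabla>\<^sub>v f|\<close> and \<open>r \<sigma>\<^sup>2 |S1|\<close> along the two families of curves.

  Each average is bounded in \<open>L\<^sup>p\<close>.  For fixed parameters \<open>z \<mapsto> traj\<close> preserves Lebesgue measure
  (\<open>nn_integral_traj\<close>), so Jensen's inequality and Tonelli's theorem treat \<open>S0\<close> and \<open>\<nabla>\<^sub>v f\<close>.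
  For \<open>S1\<close> the map from the parameters \<open>(\<tau>, c)\<close> to the point on the curve, at fixed \<open>z\<close> and \<open>\<sigma>\<close>,
  has Jacobian at least a constant times \<open>r\<^sup>Q \<sigma>\<^sup>3\<^sup>Q\<^sup>/\<^sup>2\<close> (\<open>nn_integral_params_traj_le\<close>); an
  argument in the manner of Young's convolution inequality (\<open>nn_integral_average_epowr_le_Young\<close>)
  then gives a bound from \<open>L\<^sup>q\<close> to \<open>L\<^sup>p\<close> with norm of order \<open>r\<^sup>-\<^sup>1 \<sigma>\<^sup>-\<^sup>3\<^sup>/\<^sup>2\<close>, which the factor
  \<open>r \<sigma>\<^sup>2\<close> absorbs (\<open>eLp_traj_avg_gain\<close>).  The exponent relation \<open>1/q = 1/p + 1/Q\<close> is exactly what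
  turns \<open>r\<^sup>Q\<close> into \<open>r\<close>.
\<close>

section \<open>Real powers of extended nonnegative reals\<close>

text \<open>
  With this convention at the two ends (\<open>0 epowr a = 0\<close> and \<open>\<infinity> epowr a = \<infinity>\<close> for every \<open>a\<close>,
  also for \<open>a = 0\<close>) the laws of exponents hold without side conditions, and \<^const>\<open>Lp_norm\<close>
  for a finite exponent is a power of an integral of powers.
\<close>
definition epowr :: "ennreal \<Rightarrow> real \<Rightarrow> ennreal" (infixr "epowr" 80) where
  "x epowr a = (if x = \<infinity> then \<infinity> else ennreal (enn2real x powr a))"

lemma epowr_ennreal [simp]: "0 \<le> x \<Longrightarrow> ennreal x epowr a = ennreal (x powr a)"
  by (simp add: epowr_def)

lemma epowr_top [simp]: "\<infinity> epowr a = \<infinity>" "top epowr a = top"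
  by (simp_all add: epowr_def)

lemma epowr_zero [simp]: "0 epowr a = 0"
  by (simp add: epowr_def)

lemma epowr_eq_top_iff [simp]: "x epowr a = top \<longleftrightarrow> x = top"
  by (simp add: epowr_def)

lemma epowr_one_right [simp]: "x epowr 1 = x"
  by (cases x) auto

lemma epowr_mono: "x \<le> y \<Longrightarrow> 0 \<le> a \<Longrightarrow> x epowr a \<le> y epowr a"
  by (cases x; cases y) (auto intro!: ennreal_leI powr_mono2 simp: top_unique)

lemma epowr_mult: "(x * y) epowr a = x epowr a * y epowr a"
  by (cases x; cases y)
    (auto simp: ennreal_mult[symmetric] powr_mult ennreal_mult_top ennreal_top_mult)

lemma epowr_epowr: "(x epowr a) epowr b = x epowr (a * b)"
  by (cases x) (auto simp: powr_powr)

lemma epowr_add: "x epowr (a + b) = x epowr a * x epowr b"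
  by (cases x) (auto simp: powr_add ennreal_mult)

lemma epowr_measurable [measurable]:
  assumes [measurable]: "g \<in> borel_measurable M"
  shows "(\<lambda>x. g x epowr a) \<in> borel_measurable M"
  unfolding epowr_def by measurable

text \<open>
  The tangent of the convex function \<open>x powr p\<close> at \<open>m\<close> lies below its graph.
\<close>
lemma Young_weighted_real:
  fixes p m x :: real
  assumes "1 \<le> p" "0 < m" "0 \<le> x"
  shows "p * m powr (p - 1) * x \<le> x powr p + (p - 1) * m powr p"
proof (cases "p = 1 \<or> x = 0")
  case True
  then show ?thesis
  proof
    assume "p = 1"
    then show ?thesis using assms powr_one_gt_zero_iff[of x] by simp
  next
    assume "x = 0"
    then show ?thesis using assms by simp
  qed
next
  case False
  then have p: "p > 1" and x: "x > 0" using assms by auto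
  define q where "q = p / (p - 1)"
  have q: "q > 1" "1 / p + 1 / q = 1" using p by (auto simp: q_def field_simps)
  have "x * m powr (p - 1) \<le> x powr p / p + (m powr (p - 1)) powr q / q"
    using Youngs_inequality[of p q x "m powr (p - 1)"] p q x assms by auto
  also have "(m powr (p - 1)) powr q = m powr p"
    using p by (simp add: powr_powr q_def)
  finally have "p * (x * m powr (p - 1)) \<le> p * (x powr p / p + m powr p / q)"
    using p by (intro mult_left_mono) auto
  also have "\<dots> = x powr p + (p - 1) * m powr p"
    using p by (simp add: q_def field_simps)
  finally show ?thesis by (simp add: mult_ac)
qed

section \<open>Averages of functions of two variables\<close>

text \<open>
  Jensen's inequality for the normalised measure: integrate the tangent inequality with the
  tangent taken at the mean value of \<open>h\<close>.
\<close>
lemma nn_integral_epowr_Jensen: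
  assumes "finite_measure M" and [measurable]: "h \<in> borel_measurable M" and p: "1 \<le> p"
  shows "(\<integral>\<^sup>+x. h x \<partial>M) epowr p \<le> emeasure M (space M) epowr (p - 1) * (\<integral>\<^sup>+x. h x epowr p \<partial>M)"
proof -
  interpret finite_measure M by fact
  define \<mu> where "\<mu> = measure M (space M)"
  define A where "A = (\<integral>\<^sup>+x. h x \<partial>M)"
  have mu: "emeasure M (space M) = ennreal \<mu>" "\<mu> \<ge> 0"
    by (auto simp: \<mu>_def emeasure_eq_measure)
  have Young: "ennreal (p * m powr (p - 1)) * h x \<le> h x epowr p + ennreal ((p - 1) * m powr p)"
    if "m > 0" for m x
  proof (cases "h x")
    case (real y)
    then show ?thesis
      using Young_weighted_real[OF p that, of y] p that
      by (auto simp: ennreal_mult[symmetric] ennreal_plus[symmetric] intro!: ennreal_leI simp del: ennreal_plus)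
  qed auto
  have int: "ennreal (p * m powr (p - 1)) * A \<le> (\<integral>\<^sup>+x. h x epowr p \<partial>M) + ennreal ((p - 1) * m powr p * \<mu>)"
    if "m > 0" for m
  proof -
    have "ennreal (p * m powr (p - 1)) * A = (\<integral>\<^sup>+x. ennreal (p * m powr (p - 1)) * h x \<partial>M)"
      unfolding A_def by (subst nn_integral_cmult) auto
    also have "\<dots> \<le> (\<integral>\<^sup>+x. h x epowr p + ennreal ((p - 1) * m powr p) \<partial>M)"
      using Young[OF that] by (intro nn_integral_mono) auto
    also have "\<dots> = (\<integral>\<^sup>+x. h x epowr p \<partial>M) + ennreal ((p - 1) * m powr p * \<mu>)"
      using p mu by (subst nn_integral_add) (auto simp: ennreal_mult)
    finally show ?thesis .
  qed
  consider "\<mu> = 0" | "A = 0" | "\<mu> > 0" "A = \<infinity>" | a where "\<mu> > 0" "A = ennreal a" "a > 0"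
    using mu by (cases A) (force simp: less_le)+
  then show ?thesis
  proof cases
    case 1
    then have "space M \<in> null_sets M" using mu by (intro null_setsI) auto
    then have "AE x in M. h x = 0" by (rule AE_I') auto
    then have "A = 0" unfolding A_def by (simp add: nn_integral_0_iff_AE)
    then show ?thesis unfolding A_def by simp
  next
    case 2
    then show ?thesis unfolding A_def by simp
  next
    case 3
    have "(\<integral>\<^sup>+x. h x epowr p \<partial>M) = \<infinity>"
      using int[of 1] 3 p by (auto simp: ennreal_mult_top top_unique)
    then show ?thesis
      using 3 mu unfolding A_def by (auto simp: ennreal_mult_top)
  next
    case (4 a)
    show ?thesis
    proof (cases "\<integral>\<^sup>+x. h x epowr p \<partial>M")
      case top
      then show ?thesis using 4 mu by (simp add: ennreal_mult_top)
    next
      case (real I)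
      \<comment> \<open>The mean value of \<open>h\<close>.\<close>
      define m where "m = a / \<mu>"
      have m: "m > 0" "a = m * \<mu>" using 4 by (auto simp: m_def)
      have "p * m powr (p - 1) * a \<le> I + (p - 1) * m powr p * \<mu>"
        using int[OF m(1)] 4 real p mu m
        by (auto simp: ennreal_mult[symmetric] ennreal_plus[symmetric] ennreal_le_iff simp del: ennreal_plus)
      also have "p * m powr (p - 1) * a = p * m powr p * \<mu>"
        using m powr_add[of m "p - 1" 1] by (simp add: mult_ac)
      finally have le: "m powr p * \<mu> \<le> I" by (simp add: algebra_simps)
      have "a powr p = \<mu> powr (p - 1) * (m powr p * \<mu>)"
        using m 4 powr_add[of \<mu> "p - 1" 1] by (simp add: powr_mult mult_ac)
      also have "\<dots> \<le> \<mu> powr (p - 1) * I"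
        using le by (intro mult_left_mono) auto
      finally show ?thesis
        using 4 real mu unfolding A_def[symmetric]
        by (auto simp: ennreal_mult[symmetric] intro!: ennreal_leI)
    qed
  qed
qed

text \<open>
  An average of functions, each with \<open>p\<close>-th power integral at most \<open>I\<close>, inherits this bound up to
  the total mass: a case of Minkowski's integral inequality that follows at once from Jensen's
  inequality and Tonelli's theorem.
\<close>
lemma nn_integral_average_epowr_le:
  assumes "sigma_finite_measure M" "finite_measure N" and p: "1 \<le> p"
    and [measurable]: "case_prod F \<in> borel_measurable (M \<Otimes>\<^sub>M N)"
    and I: "AE y in N. (\<integral>\<^sup>+x. F x y epowr p \<partial>M) \<le> I"
  shows "(\<integral>\<^sup>+x. (\<integral>\<^sup>+y. F x y \<partial>N) epowr p \<partial>M) \<le> emeasure N (space N) epowr p * I"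
proof -
  interpret M: sigma_finite_measure M by fact
  interpret N: finite_measure N by fact
  interpret pair_sigma_finite M N ..
  have "(\<integral>\<^sup>+x. (\<integral>\<^sup>+y. F x y \<partial>N) epowr p \<partial>M)
      \<le> (\<integral>\<^sup>+x. emeasure N (space N) epowr (p - 1) * (\<integral>\<^sup>+y. F x y epowr p \<partial>N) \<partial>M)"
    using p by (intro nn_integral_mono nn_integral_epowr_Jensen) (auto intro: N.finite_measure_axioms)
  also have "\<dots> = emeasure N (space N) epowr (p - 1) * (\<integral>\<^sup>+x. (\<integral>\<^sup>+y. F x y epowr p \<partial>N) \<partial>M)"
    by (subst nn_integral_cmult) measurable
  also have "(\<integral>\<^sup>+x. (\<integral>\<^sup>+y. F x y epowr p \<partial>N) \<partial>M) = (\<integral>\<^sup>+y. (\<integral>\<^sup>+x. F x y epowr p \<partial>M) \<partial>N)"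
    by (rule Fubini'[symmetric]) measurable
  also have "\<dots> \<le> (\<integral>\<^sup>+y. I \<partial>N)"
    using I by (rule nn_integral_mono_AE)
  also have "\<dots> = emeasure N (space N) * I" by (simp add: mult.commute)
  also have "emeasure N (space N) epowr (p - 1) * (emeasure N (space N) * I)
      = emeasure N (space N) epowr p * I"
    using epowr_add[of "emeasure N (space N)" "p - 1" 1] by (simp add: mult_ac)
  finally show ?thesis by (simp add: mult_left_mono)
qed

text \<open>
  The mechanism of Young's convolution inequality.  Jensen's inequality with exponent \<open>q\<close> reduces
  \<open>(\<integral> F x y dy)\<^sup>p\<close> to the power \<open>p/q\<close> of \<open>G x = \<integral> (F x y)\<^sup>q dy\<close>; of this power, \<open>p/q - 1\<close> is
  estimated uniformly in \<open>x\<close> by \<open>J\<close>, and the remaining single factor \<open>G x\<close> is integrated over \<open>x\<close>.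
\<close>
lemma nn_integral_average_epowr_le_Young:
  assumes "sigma_finite_measure M" "finite_measure N" and q: "1 \<le> q" "q \<le> p"
    and [measurable]: "case_prod F \<in> borel_measurable (M \<Otimes>\<^sub>M N)"
    and I: "\<And>y. y \<in> space N \<Longrightarrow> (\<integral>\<^sup>+x. F x y epowr q \<partial>M) \<le> I"
    and J: "\<And>x. x \<in> space M \<Longrightarrow> (\<integral>\<^sup>+y. F x y epowr q \<partial>N) \<le> J"
  shows "(\<integral>\<^sup>+x. (\<integral>\<^sup>+y. F x y \<partial>N) epowr p \<partial>M)
    \<le> emeasure N (space N) epowr (p - p / q + 1) * J epowr (p / q - 1) * I"
proof -
  interpret M: sigma_finite_measure M by fact
  interpret N: finite_measure N by fact
  interpret pair_sigma_finite M N ..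
  let ?m = "emeasure N (space N)"
  have pq: "p / q \<ge> 1" using q by simp
  have "(\<integral>\<^sup>+y. F x y \<partial>N) epowr p
      \<le> ?m epowr (p - p / q) * J epowr (p / q - 1) * (\<integral>\<^sup>+y. F x y epowr q \<partial>N)"
    if x: "x \<in> space M" for x
  proof -
    let ?G = "\<integral>\<^sup>+y. F x y epowr q \<partial>N"
    have "(\<integral>\<^sup>+y. F x y \<partial>N) epowr p = ((\<integral>\<^sup>+y. F x y \<partial>N) epowr q) epowr (p / q)"
      using q by (simp add: epowr_epowr)
    also have "\<dots> \<le> (?m epowr (q - 1) * ?G) epowr (p / q)"
      using q pq x by (intro epowr_mono nn_integral_epowr_Jensen) (auto intro: N.finite_measure_axioms)
    also have "\<dots> = ?m epowr (p - p / q) * (?G epowr (p / q - 1) * ?G)"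
      using q epowr_add[of ?G "p / q - 1" 1]
      by (simp add: epowr_mult epowr_epowr field_simps)
    also have "\<dots> \<le> ?m epowr (p - p / q) * (J epowr (p / q - 1) * ?G)"
      using J[OF x] pq by (intro mult_left_mono mult_right_mono epowr_mono) auto
    finally show ?thesis by (simp add: mult_ac)
  qed
  then have "(\<integral>\<^sup>+x. (\<integral>\<^sup>+y. F x y \<partial>N) epowr p \<partial>M)
      \<le> (\<integral>\<^sup>+x. ?m epowr (p - p / q) * J epowr (p / q - 1) * (\<integral>\<^sup>+y. F x y epowr q \<partial>N) \<partial>M)"
    by (intro nn_integral_mono)
  also have "\<dots> = ?m epowr (p - p / q) * J epowr (p / q - 1) * (\<integral>\<^sup>+x. (\<integral>\<^sup>+y. F x y epowr q \<partial>N) \<partial>M)"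
    by (subst nn_integral_cmult) measurable
  also have "(\<integral>\<^sup>+x. (\<integral>\<^sup>+y. F x y epowr q \<partial>N) \<partial>M) = (\<integral>\<^sup>+y. (\<integral>\<^sup>+x. F x y epowr q \<partial>M) \<partial>N)"
    by (rule Fubini'[symmetric]) measurable
  also have "\<dots> \<le> (\<integral>\<^sup>+y. I \<partial>N)"
    using I by (intro nn_integral_mono) auto
  also have "\<dots> = ?m * I" by (simp add: mult.commute)
  also have "?m epowr (p - p / q) * J epowr (p / q - 1) * (?m * I)
      = ?m epowr (p - p / q + 1) * J epowr (p / q - 1) * I"
    using epowr_add[of ?m "p - p / q" 1] by (simp add: mult_ac)
  finally show ?thesis by (simp add: mult_left_mono)
qed

section \<open>Lebesgue norms of extended-valued functions\<close>

text \<open>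
  The averages along curves are nonnegative extended-valued functions, for which \<^const>\<open>Lp_norm\<close>
  is not defined; on norms of vector-valued functions the two agree.
\<close>
definition eLp :: "ennreal \<Rightarrow> 'a measure \<Rightarrow> ('a \<Rightarrow> ennreal) \<Rightarrow> ennreal" where
  "eLp p M U = (if p = \<infinity> then esssup M U
     else (\<integral>\<^sup>+z. U z epowr enn2real p \<partial>M) epowr (1 / enn2real p))"

lemma Lp_norm_eq_eLp: "Lp_norm p M f = eLp p M (\<lambda>z. ennreal (norm (f z)))"
  by (simp add: Lp_norm_def eLp_def epowr_def Let_def)

lemma eLp_mono:
  assumes "U \<in> borel_measurable M" "\<And>z. U z \<le> V z"
  shows "eLp p M U \<le> eLp p M V"
  using assms unfolding eLp_def
  by (auto intro!: esssup_mono epowr_mono nn_integral_mono)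

lemma eLp_le_const:
  assumes "U \<in> borel_measurable M" "\<And>z. U z \<le> c"
  shows "eLp \<infinity> M U \<le> c"
  using assms by (auto simp: eLp_def intro!: esssup_I)

lemma eLp_le_iff:
  assumes "1 \<le> p"
  shows "eLp (ennreal p) M U \<le> c \<longleftrightarrow> (\<integral>\<^sup>+z. U z epowr p \<partial>M) \<le> c epowr p"
proof
  assume "eLp (ennreal p) M U \<le> c"
  then have "(eLp (ennreal p) M U) epowr p \<le> c epowr p"
    using assms by (intro epowr_mono) auto
  then show "(\<integral>\<^sup>+z. U z epowr p \<partial>M) \<le> c epowr p"
    using assms by (simp add: eLp_def epowr_epowr)
next
  assume "(\<integral>\<^sup>+z. U z epowr p \<partial>M) \<le> c epowr p"
  then have "(\<integral>\<^sup>+z. U z epowr p \<partial>M) epowr (1 / p) \<le> (c epowr p) epowr (1 / p)"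
    using assms by (intro epowr_mono) auto
  then show "eLp (ennreal p) M U \<le> c"
    using assms by (simp add: eLp_def epowr_epowr)
qed

lemma nn_integral_epowr_eq:
  assumes "1 \<le> p"
  shows "(\<integral>\<^sup>+z. U z epowr p \<partial>M) = eLp (ennreal p) M U epowr p"
  using assms by (simp add: eLp_def epowr_epowr)

lemma exponent_cases:
  assumes "(1::ennreal) \<le> p"
  obtains "p = \<infinity>" | p' where "1 \<le> p'" "p = ennreal p'"
proof (cases p)
  case (real r)
  then have "ennreal 1 \<le> ennreal r" using assms by simp
  then have "1 \<le> r" using real by (simp add: ennreal_le_iff2 del: ennreal_1)
  then show ?thesis using real that(2) by blast
qed (use that(1) in auto)

lemma eLp_cmult:
  assumes "1 \<le> p" and [measurable]: "U \<in> borel_measurable M" and c: "0 < c"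
  shows "eLp p M (\<lambda>z. ennreal c * U z) \<le> ennreal c * eLp p M U"
proof (cases rule: exponent_cases[OF assms(1)])
  case 1
  have "AE z in M. ennreal c * U z \<le> ennreal c * esssup M U"
    using esssup_AE[of U M] by eventually_elim (auto intro: mult_left_mono)
  then show ?thesis
    using 1 by (auto simp: eLp_def intro!: esssup_I)
next
  case (2 p')
  then show ?thesis
    using c by (simp add: eLp_le_iff epowr_mult nn_integral_cmult nn_integral_epowr_eq)
qed

text \<open>
  The triangle inequality with a constant, from \<open>(x + y)\<^sup>p \<le> 2\<^sup>p max (x, y)\<^sup>p\<close>.  That the constant does not
  depend on \<open>p\<close> lets finite and infinite exponents be treated alike.
\<close>
lemma eLp_add:
  assumes "1 \<le> p" and [measurable]: "U \<in> borel_measurable M" "V \<in> borel_measurable M"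
  shows "eLp p M (\<lambda>z. U z + V z) \<le> 4 * (eLp p M U + eLp p M V)"
proof (cases rule: exponent_cases[OF assms(1)])
  case 1
  have "AE z in M. U z + V z \<le> esssup M U + esssup M V"
    using esssup_AE[of U M] esssup_AE[of V M] by eventually_elim (auto intro: add_mono)
  then have "esssup M (\<lambda>z. U z + V z) \<le> 1 * (esssup M U + esssup M V)"
    by (auto intro!: esssup_I)
  also have "\<dots> \<le> 4 * (esssup M U + esssup M V)"
    by (intro mult_right_mono) auto
  finally show ?thesis using 1 by (simp add: eLp_def)
next
  case (2 p')
  let ?X = "eLp p M U" and ?Y = "eLp p M V"
  have pt: "(x + y) epowr p' \<le> 2 epowr p' * (x epowr p' + y epowr p')" for x y :: ennreal
  proof -
    have "(x + y) epowr p' \<le> (2 * max x y) epowr p'"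
      using 2 by (intro epowr_mono) (auto simp: mult_2 intro!: add_mono)
    also have "\<dots> = 2 epowr p' * (max x y epowr p')" by (simp add: epowr_mult)
    also have "\<dots> \<le> 2 epowr p' * (x epowr p' + y epowr p')"
      by (intro mult_left_mono) (auto simp: max_def)
    finally show ?thesis .
  qed
  have "(\<integral>\<^sup>+z. (U z + V z) epowr p' \<partial>M) \<le> (\<integral>\<^sup>+z. 2 epowr p' * (U z epowr p' + V z epowr p') \<partial>M)"
    by (intro nn_integral_mono pt)
  also have "\<dots> = 2 epowr p' * (?X epowr p' + ?Y epowr p')"
    using 2 by (simp add: nn_integral_cmult nn_integral_add nn_integral_epowr_eq)
  also have "\<dots> \<le> 2 epowr p' * (2 * (?X + ?Y) epowr p')"
    unfolding mult_2 using 2 by (intro mult_left_mono add_mono epowr_mono) auto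
  also have "\<dots> \<le> 2 epowr p' * (2 epowr p' * (?X + ?Y) epowr p')"
  proof -
    have "ennreal 2 \<le> ennreal (2 powr p')"
      using 2 powr_mono[of 1 p' 2] by (intro ennreal_leI) auto
    then have "2 \<le> (2::ennreal) epowr p'"
      using epowr_ennreal[of 2 p'] by simp
    then show ?thesis by (intro mult_left_mono mult_right_mono) auto
  qed
  also have "\<dots> = (4 * (?X + ?Y)) epowr p'"
  proof -
    have "(4::ennreal) = 2 * 2" by simp
    then show ?thesis by (simp only: epowr_mult mult.assoc)
  qed
  finally show ?thesis using 2 by (simp add: eLp_le_iff)
qed

lemma eLp_measure_preserving:
  assumes "1 \<le> p" and T: "T \<in> measurable M M" "distr M M T = M"
    and [measurable]: "U \<in> borel_measurable M"
  shows "eLp p M (\<lambda>z. U (T z)) \<le> eLp p M U"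
proof (cases rule: exponent_cases[OF assms(1)])
  case 1
  have "AE z in distr M M T. U z \<le> esssup M U"
    unfolding T(2) by (rule esssup_AE)
  then have "AE z in M. U (T z) \<le> esssup M U"
    using T by (subst (asm) AE_distr_iff) auto
  then show ?thesis
    using 1 T(1) by (auto simp: eLp_def intro!: esssup_I)
next
  case (2 p')
  have "(\<integral>\<^sup>+z. U z epowr p' \<partial>M) = (\<integral>\<^sup>+z. U z epowr p' \<partial>distr M M T)"
    using T by simp
  also have "\<dots> = (\<integral>\<^sup>+z. U (T z) epowr p' \<partial>M)"
    using T(1) by (subst nn_integral_distr) auto
  finally show ?thesis using 2 by (simp add: eLp_le_iff nn_integral_epowr_eq)
qed

section \<open>Integration by parts against a bump function\<close>

lemma nn_integral_lborel_affine:
  fixes G :: "'a::euclidean_space \<Rightarrow> ennreal"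
  assumes [measurable]: "G \<in> borel_measurable borel" and c: "c \<noteq> 0"
  shows "ennreal (\<bar>c\<bar> ^ DIM('a)) * (\<integral>\<^sup>+x. G (t + c *\<^sub>R x) \<partial>lborel) = (\<integral>\<^sup>+x. G x \<partial>lborel)"
  using c by (subst (2) lborel_affine[of c t])
     (auto simp: nn_integral_density nn_integral_distr nn_integral_cmult)

lemma nn_integral_lborel_translate:
  fixes G :: "'a::euclidean_space \<Rightarrow> ennreal"
  assumes [measurable]: "G \<in> borel_measurable borel"
  shows "(\<integral>\<^sup>+x. G (t + x) \<partial>lborel) = (\<integral>\<^sup>+x. G x \<partial>lborel)"
  using nn_integral_lborel_affine[OF assms, of 1 t] by simp

lemma integral_lborel_translate:
  fixes G :: "'a::euclidean_space \<Rightarrow> real"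
  assumes [measurable]: "G \<in> borel_measurable borel"
  shows "(\<integral>x. G (t + x) \<partial>lborel) = (\<integral>x. G x \<partial>lborel)"
  by (subst (2) lborel_affine[of 1 t]) (auto simp: density_1 integral_distr)

lemma integrable_compact_support:
  fixes g :: "'a::euclidean_space \<Rightarrow> 'b::{banach,second_countable_topology}"
  assumes "continuous_on UNIV g" "compact S" "\<And>x. x \<notin> S \<Longrightarrow> g x = 0"
  shows "integrable lborel g"
proof -
  have "integrable lborel (\<lambda>x. indicator S x *\<^sub>R g x)"
    using assms by (intro borel_integrable_compact) (auto intro: continuous_on_subset)
  also have "(\<lambda>x. indicator S x *\<^sub>R g x) = g"
    using assms(3) by (auto simp: indicator_def fun_eq_iff)
  finally show ?thesis .
qed

text \<open>
  The integral of \<open>G (c + u) - G c\<close> vanishes by translation invariance.  By the fundamental theorem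
  of calculus it is also the integral over \<open>e \<in> [0, 1]\<close> of \<open>\<integral> g (c + e u) dc\<close>, and again by
  translation invariance this inner integral does not depend on \<open>e\<close>.
\<close>
lemma integral_line_derivative_eq_0:
  fixes G g :: "'a::euclidean_space \<Rightarrow> real"
  assumes G: "continuous_on UNIV G" and g: "continuous_on UNIV g"
    and deriv: "\<And>c. ((\<lambda>e. G (c + e *\<^sub>R u)) has_real_derivative g c) (at 0)"
    and G0: "\<And>c. norm c > R \<Longrightarrow> G c = 0" and g0: "\<And>c. norm c > R \<Longrightarrow> g c = 0"
  shows "(\<integral>c. g c \<partial>lborel) = 0"
proof -
  have [measurable]: "G \<in> borel_measurable borel" "g \<in> borel_measurable borel"
    using G g by (auto intro: borel_measurable_continuous_onI)
  have intG: "integrable lborel G"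
    using G G0 by (intro integrable_compact_support[where S="cball 0 R"]) auto
  have intGu: "integrable lborel (\<lambda>c. G (c + u))"
  proof (intro integrable_compact_support[where S="cball 0 (R + norm u)"])
    fix c :: 'a assume "c \<notin> cball 0 (R + norm u)"
    then have "norm (c + u) > R"
      using norm_triangle_ineq4[of "c + u" u] by simp
    then show "G (c + u) = 0" by (rule G0)
  qed (auto intro!: continuous_on_compose2[OF G] continuous_intros)
  have line: "(\<integral>e. indicator {0..1} e *\<^sub>R g (c + e *\<^sub>R u) \<partial>lborel) = G (c + u) - G c" for c
  proof -
    have "((\<lambda>e. G (c + e *\<^sub>R u)) has_real_derivative g (c + x *\<^sub>R u)) (at x)" for x
      using deriv[of "c + x *\<^sub>R u"] DERIV_shift[of "\<lambda>e. G (c + e *\<^sub>R u)" "g (c + x *\<^sub>R u)" 0 x]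
      by (simp add: algebra_simps)
    then have "(\<integral>e. indicator {0..1} e *\<^sub>R g (c + e *\<^sub>R u) \<partial>lborel) = G (c + 1 *\<^sub>R u) - G (c + 0 *\<^sub>R u)"
      by (intro integral_FTC_Icc)
        (auto simp: has_real_derivative_iff_has_vector_derivative
          intro: has_vector_derivative_at_within intro!: continuous_on_compose2[OF g] continuous_intros)
    then show ?thesis by simp
  qed
  have int2: "integrable (lborel \<Otimes>\<^sub>M lborel) (\<lambda>(c, e). indicator {0..1} e *\<^sub>R g (c + e *\<^sub>R u))"
  proof -
    let ?K = "cball (0::'a) (R + norm u) \<times> {0..1::real}"
    have "integrable lborel (\<lambda>z. indicator ?K z *\<^sub>R g (fst z + snd z *\<^sub>R u))"
      by (intro borel_integrable_compact compact_Times)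
        (auto intro!: continuous_on_compose2[OF g] continuous_intros)
    also have "(\<lambda>z. indicator ?K z *\<^sub>R g (fst z + snd z *\<^sub>R u))
        = (\<lambda>(c, e). indicator {0..1} e *\<^sub>R g (c + e *\<^sub>R u))"
    proof (intro ext, clarify)
      fix c e
      show "indicator ?K (c, e) *\<^sub>R g (fst (c, e) + snd (c, e) *\<^sub>R u)
          = indicator {0..1} e *\<^sub>R g (c + e *\<^sub>R u)"
      proof (cases "norm c > R + norm u \<and> e \<in> {0..1}")
        case True
        then have "norm (e *\<^sub>R u) \<le> norm u" by (auto simp: mult_left_le_one_le)
        then have "norm (c + e *\<^sub>R u) > R"
          using True norm_triangle_ineq4[of "c + e *\<^sub>R u" "e *\<^sub>R u"] by simp
        then show ?thesis by (simp add: g0)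
      qed (auto simp: indicator_def)
    qed
    finally show ?thesis by (simp add: lborel_prod)
  qed
  have "0 = (\<integral>c. G (c + u) - G c \<partial>lborel)"
    using intG intGu integral_lborel_translate[of G u] by (simp add: add.commute)
  also have "\<dots> = (\<integral>c. (\<integral>e. indicator {0..1} e *\<^sub>R g (c + e *\<^sub>R u) \<partial>lborel) \<partial>lborel)"
    by (simp only: line)
  also have "\<dots> = (\<integral>e. (\<integral>c. indicator {0..1} e *\<^sub>R g (c + e *\<^sub>R u) \<partial>lborel) \<partial>lborel)"
    using lborel_pair.Fubini_integral[OF int2] by simp
  also have "\<dots> = (\<integral>e. indicator {0..1::real} e * (\<integral>c. g c \<partial>lborel) \<partial>lborel)"
  proof -
    have "(\<integral>c. g (c + e *\<^sub>R u) \<partial>lborel) = (\<integral>c. g c \<partial>lborel)" for e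
      using integral_lborel_translate[of g "e *\<^sub>R u"] by (simp add: add.commute)
    then show ?thesis by simp
  qed
  also have "\<dots> = (\<integral>c. g c \<partial>lborel)" by simp
  finally show ?thesis ..
qed

lemma open_AE_empty:
  fixes U :: "'a::euclidean_space set"
  assumes "open U" "AE z in lborel. z \<notin> U"
  shows "U = {}"
proof -
  have "U \<in> null_sets lborel"
    using assms by (subst AE_iff_null_sets) auto
  then have "negligible U"
    by (simp add: negligible_iff_null_sets null_sets_completionI)
  then show ?thesis using open_not_negligible assms(1) by blast
qed

text \<open>
  A single integration by parts requires only continuous differentiability, so this simple
  polynomial profile serves as the weight.
\<close>
definition bump :: "'a::euclidean_space \<Rightarrow> real" where
  "bump c = (max 0 (1 - c \<bullet> c))\<^sup>2"

lemma bump_nonneg: "0 \<le> bump c"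
  by (simp add: bump_def)

lemma bump_le_1: "bump c \<le> 1"
  by (simp add: bump_def power_le_one)

lemma max_0_outside_ball: "norm c > 1 \<Longrightarrow> max 0 (1 - (c::'a::euclidean_space) \<bullet> c) = 0"
  using power_mono[of 1 "norm c" 2] by (simp add: power2_norm_eq_inner)

lemma bump_eq_0: "norm c > 1 \<Longrightarrow> bump c = 0"
  by (simp add: bump_def max_0_outside_ball)

lemma continuous_on_bump [continuous_intros]:
  "continuous_on S h \<Longrightarrow> continuous_on S (\<lambda>x. bump (h x))"
  unfolding bump_def by (intro continuous_intros)

lemma DERIV_max_0_squared: "((\<lambda>y. (max 0 y)\<^sup>2) has_real_derivative 2 * max 0 y) (at (y::real))"
proof -
  consider "y > 0" | "y < 0" | "y = 0" by linarith
  then show ?thesis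
  proof cases
    case 1
    have "((\<lambda>y. y\<^sup>2) has_real_derivative 2 * max 0 y) (at y)"
      using 1 by (auto intro!: derivative_eq_intros)
    then show ?thesis
      by (rule DERIV_cong_ev[THEN iffD1, rotated -1]) 
        (use 1 eventually_nhds_in_open[of "{0<..}" y] in \<open>auto elim!: eventually_mono\<close>)
  next
    case 2
    have "((\<lambda>y. 0) has_real_derivative 2 * max 0 y) (at y)"
      using 2 by (auto intro!: derivative_eq_intros)
    then show ?thesis
      by (rule DERIV_cong_ev[THEN iffD1, rotated -1]) 
        (use 2 eventually_nhds_in_open[of "{..<0}" y] in \<open>auto elim!: eventually_mono\<close>)
  next
    case 3
    have "((\<lambda>h::real. max 0 h) \<longlongrightarrow> max 0 0) (at 0)" by (intro tendsto_intros)
    then have "((\<lambda>h::real. max 0 h) \<longlongrightarrow> 0) (at 0)" by simp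
    then have "((\<lambda>h::real. (max 0 h)\<^sup>2 / h) \<longlongrightarrow> 0) (at 0)"
      by (rule Lim_transform_eventually) (auto simp: eventually_at_filter max_def power2_eq_square)
    then show ?thesis using 3 by (simp add: DERIV_def)
  qed
qed

lemma bump_line_derivative:
  "((\<lambda>e. bump (c + e *\<^sub>R u)) has_real_derivative - 4 * max 0 (1 - c \<bullet> c) * (c \<bullet> u)) (at 0)"
proof -
  have "((\<lambda>e. 1 - (c + e *\<^sub>R u) \<bullet> (c + e *\<^sub>R u)) has_real_derivative - 2 * (c \<bullet> u)) (at 0)"
    unfolding inner_simps by (auto intro!: derivative_eq_intros simp: inner_commute)
  from DERIV_chain2[OF DERIV_max_0_squared this] show ?thesis
    unfolding bump_def by (simp add: mult_ac)
qed

lemma integrable_bump_mult: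
  fixes g :: "'a::euclidean_space \<Rightarrow> real"
  assumes "continuous_on UNIV g"
  shows "integrable lborel (\<lambda>c. g c * bump c)"
  using assms by (intro integrable_compact_support[where S="cball 0 1"] continuous_intros)
    (auto simp: bump_eq_0)

lemma integral_bump_pos: "(\<integral>c. bump (c::'a::euclidean_space) \<partial>lborel) > 0"
proof -
  have int: "integrable lborel (bump :: 'a \<Rightarrow> real)"
    using integrable_bump_mult[of "\<lambda>_::'a. 1"] by simp
  have "\<not> (AE c in lborel. bump (c::'a) = 0)"
  proof
    assume "AE c in lborel. bump (c::'a) = 0"
    moreover have "open {c. bump (c::'a) \<noteq> 0}"
      by (intro open_Collect_neq continuous_intros)
    ultimately have "{c. bump (c::'a) \<noteq> 0} = {}"
      by (intro open_AE_empty) auto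
    then have "bump (0::'a) = 0" by blast
    then show False by (simp add: bump_def)
  qed
  then show ?thesis
    using integral_nonneg_eq_0_iff_AE[OF int] bump_nonneg
      integral_nonneg_AE[of "bump :: 'a \<Rightarrow> real" lborel] by (auto simp: less_le)
qed

lemma integration_by_parts_bump:
  fixes F F' :: "'a::euclidean_space \<Rightarrow> real"
  assumes F: "continuous_on UNIV F" and F': "continuous_on UNIV F'"
    and deriv: "\<And>c. ((\<lambda>e. F (c + e *\<^sub>R u)) has_real_derivative F' c) (at 0)"
  shows "(\<integral>c. F' c * bump c \<partial>lborel) = (\<integral>c. F c * (4 * max 0 (1 - c \<bullet> c) * (c \<bullet> u)) \<partial>lborel)"
proof -
  let ?b = "\<lambda>c. 4 * max 0 (1 - c \<bullet> c) * (c \<bullet> u)"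
  have "(\<integral>c. F' c * bump c - F c * ?b c \<partial>lborel) = 0"
  proof (rule integral_line_derivative_eq_0[where G="\<lambda>c. F c * bump c" and u=u and R=1])
    show "((\<lambda>e. F (c + e *\<^sub>R u) * bump (c + e *\<^sub>R u)) has_real_derivative F' c * bump c - F c * ?b c) (at 0)" for c
      using DERIV_mult[OF deriv[of c] bump_line_derivative[of c u]] by (simp add: mult_ac)
  qed (auto intro!: continuous_intros F F' simp: bump_eq_0 max_0_outside_ball)
  moreover have "integrable lborel (\<lambda>c. F' c * bump c)"
    by (rule integrable_bump_mult[OF F'])
  moreover have "integrable lborel (\<lambda>c. F c * ?b c)"
    by (intro integrable_compact_support[where S="cball 0 1"])
      (auto intro!: continuous_intros F simp: max_0_outside_ball)
  ultimately show ?thesis by simp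
qed

text \<open>
  The set where the bound fails is open and null, hence empty.  Averages over curves through a fixed
  point can then be bounded at every point instead of almost every point.
\<close>
lemma continuous_le_of_AE_lborel:
  fixes g :: "'a::euclidean_space \<Rightarrow> real"
  assumes g: "continuous_on UNIV g" and AE: "AE z in lborel. ennreal (g z) \<le> S"
  shows "ennreal (g z) \<le> S"
proof -
  have "continuous_on UNIV (\<lambda>z. ennreal (g z))"
    using g by (intro continuous_on_ennreal)
  then have "open {z. ennreal (g z) > S}"
    by (intro open_Collect_less continuous_intros) auto
  then have "{z. ennreal (g z) > S} = {}"
    using AE by (intro open_AE_empty) (auto simp: not_less)
  then show ?thesis by (auto simp: not_less[symmetric])
qed

section \<open>Derivatives of Schwartz functions\<close>

lemma has_real_derivative_dir_deriv:
  fixes g :: "'a::real_normed_vector \<Rightarrow> real"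
  assumes "g differentiable (at z)"
  shows "((\<lambda>e. g (z + e *\<^sub>R w)) has_real_derivative dir_deriv w g z) (at 0)"
proof -
  let ?D = "frechet_derivative g (at z)"
  have D: "(g has_derivative ?D) (at z)"
    using assms by (simp add: frechet_derivative_works)
  have "((\<lambda>e. g (z + e *\<^sub>R w)) has_derivative (\<lambda>e. ?D (e *\<^sub>R w))) (at 0)"
    by (rule has_derivative_compose[of _ "\<lambda>e. e *\<^sub>R w" 0 UNIV g ?D, simplified])
       (use D in \<open>auto intro!: derivative_eq_intros\<close>)
  also have "(\<lambda>e. ?D (e *\<^sub>R w)) = (*) (?D w)"
    using has_derivative_linear[OF D] by (auto simp: linear_scale mult.commute)
  finally show ?thesis by (simp add: has_field_derivative_def dir_deriv_def)
qed

lemma schwartz_differentiable: "f \<in> schwartz \<Longrightarrow> f differentiable (at z)"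
  unfolding schwartz_def by (auto dest: spec[of _ "[]"])

lemma schwartz_continuous: "f \<in> schwartz \<Longrightarrow> continuous_on UNIV f"
  by (simp add: continuous_at_imp_continuous_on differentiable_imp_continuous_within schwartz_differentiable)

lemma schwartz_dir_deriv_continuous:
  assumes "f \<in> schwartz" "u \<in> Basis"
  shows "continuous_on UNIV (dir_deriv u f)"
proof -
  have "set [u] \<subseteq> Basis" using assms by simp
  then have "iter_deriv [u] f differentiable (at z)" for z
    using assms(1) unfolding schwartz_def by blast
  then show ?thesis
    by (simp add: continuous_at_imp_continuous_on differentiable_imp_continuous_within)
qed

section \<open>Kinetic trajectories\<close>

text \<open>
  The curve with time \<open>t + r\<^sup>2 \<tau> \<sigma>\<^sup>3\<close> and velocity \<open>v + r (\<sigma> a + \<sigma>\<^sup>2 b)\<close>; its position is the integral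
  of velocity times the derivative of time, whence the coefficients \<open>3/4\<close> and \<open>3/5\<close>.  The two
  different powers of \<open>\<sigma>\<close> make position and velocity independent functions of \<open>(a, b)\<close>, with
  Jacobian of order \<open>\<sigma>\<^sup>6\<^sup>d\<close>.  These powers are a compromise: the velocity must have bounded derivative,
  while the Jacobian must not degenerate so fast that the \<open>L\<^sup>q\<close>-\<open>L\<^sup>p\<close> bound ceases to be integrable
  at \<open>\<sigma> = 0\<close>.

  The vector \<open>k\<close> steers the endpoint: at \<open>\<sigma> = 1\<close> it leaves the velocity unchanged and displaces the
  position by \<open>r\<^sup>3 (3/4 - 3/5) k\<close>.  Dividing it by \<open>\<tau>\<close> makes this displacement independent of \<open>\<tau>\<close>.
\<close>
definition traj :: "real \<Rightarrow> real ^ 'n \<Rightarrow> real \<Rightarrow> real \<Rightarrow> 'n::finite phase \<Rightarrow> (real ^ 'n) \<times> (real ^ 'n) \<Rightarrow> 'n phase"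
  where "traj r k \<tau> \<sigma> z c =
    (let a = fst c + (1 / \<tau>) *\<^sub>R k; b = snd c - (1 / \<tau>) *\<^sub>R k; v = snd (snd z)
     in (fst z + r\<^sup>2 * \<tau> * \<sigma> ^ 3,
         fst (snd z) + (r\<^sup>2 * \<tau> * \<sigma> ^ 3) *\<^sub>R v
           + (r ^ 3 * \<tau>) *\<^sub>R ((3/4 * \<sigma> ^ 4) *\<^sub>R a + (3/5 * \<sigma> ^ 5) *\<^sub>R b),
         v + r *\<^sub>R (\<sigma> *\<^sub>R a + \<sigma>\<^sup>2 *\<^sub>R b)))"

lemma traj_0 [simp]: "traj r k \<tau> 0 z c = z"
  by (simp add: traj_def Let_def prod_eq_iff)

lemma traj_meet:
  assumes "r > 0" "\<tau> > 0"
  shows "traj r (- (20 / (3 * r ^ 3)) *\<^sub>R h) \<tau> 1 (t, x + h, v) c = traj r 0 \<tau> 1 (t, x, v) c"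
  using assms by (simp add: traj_def Let_def vec_eq_iff field_simps)

text \<open>
  In this direction of \<open>(a, b)\<close> the contributions to the position cancel and those to the velocity add
  up to \<open>w\<close> (namely \<open>- 4 w + 5 w\<close>), so that derivatives in \<open>v\<close> at the point on the curve are
  derivatives with respect to the parameters.
\<close>
lemma traj_shift_velocity:
  assumes "r > 0" "\<sigma> > 0"
  shows "traj r k \<tau> \<sigma> z (c + e *\<^sub>R (- (4 / (r * \<sigma>)) *\<^sub>R w, (5 / (r * \<sigma>\<^sup>2)) *\<^sub>R w))
    = traj r k \<tau> \<sigma> z c + e *\<^sub>R (0, 0, w)"
proof -
  have 1: "r * (\<sigma> * (4 / (r * \<sigma>))) = 4" "r * (\<sigma>\<^sup>2 * (5 / (r * \<sigma>\<^sup>2))) = 5"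
    using assms by auto
  have 2: "3 / 4 * \<sigma> ^ 4 * (4 / (r * \<sigma>)) = 3 / 5 * \<sigma> ^ 5 * (5 / (r * \<sigma>\<^sup>2))"
    using assms by (simp add: field_simps power_numeral_reduce)
  show ?thesis
  proof (intro prod_eqI)
    show "fst (snd (traj r k \<tau> \<sigma> z (c + e *\<^sub>R (- (4 / (r * \<sigma>)) *\<^sub>R w, (5 / (r * \<sigma>\<^sup>2)) *\<^sub>R w))))
        = fst (snd (traj r k \<tau> \<sigma> z c + e *\<^sub>R (0, 0, w)))"
      using arg_cong[OF 2, of "\<lambda>y. r ^ 3 * \<tau> * e * y * w $ i" for i]
      unfolding traj_def Let_def by (simp add: vec_eq_iff algebra_simps)
    show "snd (snd (traj r k \<tau> \<sigma> z (c + e *\<^sub>R (- (4 / (r * \<sigma>)) *\<^sub>R w, (5 / (r * \<sigma>\<^sup>2)) *\<^sub>R w))))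
        = snd (snd (traj r k \<tau> \<sigma> z c + e *\<^sub>R (0, 0, w)))"
      using assms unfolding traj_def Let_def by (simp add: vec_eq_iff field_simps power2_eq_square)
  qed (simp add: traj_def Let_def)
qed

lemma continuous_on_traj [continuous_intros]:
  assumes "continuous_on S s" "continuous_on S z" "continuous_on S c"
  shows "continuous_on S (\<lambda>x. traj r k \<tau> (s x) (z x) (c x))"
  unfolding traj_def Let_def by (intro continuous_intros assms)

lemma traj_measurable [measurable (raw)]:
  assumes [measurable]: "T \<in> borel_measurable M" "s \<in> borel_measurable M"
    "z \<in> measurable M borel" "c \<in> measurable M borel"
  shows "(\<lambda>x. traj r k (T x) (s x) (z x) (c x)) \<in> measurable M borel"
proof -
  have [measurable]: "(\<lambda>x. fst (z x)) \<in> borel_measurable M" "(\<lambda>x. fst (snd (z x))) \<in> borel_measurable M"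
    "(\<lambda>x. snd (snd (z x))) \<in> borel_measurable M" "(\<lambda>x. fst (c x)) \<in> borel_measurable M"
    "(\<lambda>x. snd (c x)) \<in> borel_measurable M"
    by (auto intro!: measurable_compose[OF assms(3)] measurable_compose[OF assms(4)]
        borel_measurable_continuous_onI continuous_intros)
  show ?thesis unfolding traj_def Let_def by measurable
qed

lemma nn_integral_pair_lborel:
  fixes G :: "'a::euclidean_space \<times> 'b::euclidean_space \<Rightarrow> ennreal"
  assumes "G \<in> borel_measurable borel"
  shows "(\<integral>\<^sup>+z. G z \<partial>lborel) = (\<integral>\<^sup>+x. \<integral>\<^sup>+y. G (x, y) \<partial>lborel \<partial>lborel)"
proof -
  have "G \<in> borel_measurable (lborel \<Otimes>\<^sub>M lborel)" using assms by (simp add: lborel_prod)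
  from lborel.nn_integral_fst[OF this] show ?thesis by (simp add: lborel_prod)
qed

lemma nn_integral_pair_lborel_swap:
  fixes G :: "'a::euclidean_space \<times> 'b::euclidean_space \<Rightarrow> ennreal"
  assumes "G \<in> borel_measurable borel"
  shows "(\<integral>\<^sup>+z. G z \<partial>lborel) = (\<integral>\<^sup>+y. \<integral>\<^sup>+x. G (x, y) \<partial>lborel \<partial>lborel)"
proof -
  have "G \<in> borel_measurable (lborel \<Otimes>\<^sub>M lborel)" using assms by (simp add: lborel_prod)
  from lborel_pair.nn_integral_snd[OF this] show ?thesis by (simp add: lborel_prod)
qed

text \<open>
  For fixed parameters the map is a translation composed with the shear \<open>x \<mapsto> x + T v\<close>.
\<close>
lemma nn_integral_traj:
  fixes G :: "'n::finite phase \<Rightarrow> ennreal"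
  assumes [measurable]: "G \<in> borel_measurable borel"
  shows "(\<integral>\<^sup>+z. G (traj r k \<tau> \<sigma> z c) \<partial>lborel) = (\<integral>\<^sup>+z. G z \<partial>lborel)"
proof -
  define T where "T = r\<^sup>2 * \<tau> * \<sigma> ^ 3"
  define X where "X = (r ^ 3 * \<tau>) *\<^sub>R ((3/4 * \<sigma> ^ 4) *\<^sub>R (fst c + (1 / \<tau>) *\<^sub>R k)
    + (3/5 * \<sigma> ^ 5) *\<^sub>R (snd c - (1 / \<tau>) *\<^sub>R k))"
  define V where "V = r *\<^sub>R (\<sigma> *\<^sub>R (fst c + (1 / \<tau>) *\<^sub>R k) + \<sigma>\<^sup>2 *\<^sub>R (snd c - (1 / \<tau>) *\<^sub>R k))"
  have traj: "traj r k \<tau> \<sigma> (t, x, v) c = (T + t, (T *\<^sub>R v + X) + x, V + v)" for t x v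
    by (simp add: traj_def Let_def T_def X_def V_def algebra_simps)
  have "(\<integral>\<^sup>+z. G (traj r k \<tau> \<sigma> z c) \<partial>lborel)
      = (\<integral>\<^sup>+t. \<integral>\<^sup>+v. \<integral>\<^sup>+x. G (T + t, (T *\<^sub>R v + X) + x, V + v) \<partial>lborel \<partial>lborel \<partial>lborel)"
    by (subst nn_integral_pair_lborel, measurable)
       (subst nn_integral_pair_lborel_swap, measurable, simp only: traj)
  also have "\<dots> = (\<integral>\<^sup>+t. \<integral>\<^sup>+v. \<integral>\<^sup>+x. G (T + t, x, V + v) \<partial>lborel \<partial>lborel \<partial>lborel)"
    by (intro nn_integral_cong nn_integral_lborel_translate) measurable
  also have "\<dots> = (\<integral>\<^sup>+t. \<integral>\<^sup>+v. \<integral>\<^sup>+x. G (T + t, x, v) \<partial>lborel \<partial>lborel \<partial>lborel)"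
    by (intro nn_integral_cong nn_integral_lborel_translate[where G="\<lambda>v. \<integral>\<^sup>+x. G (s, x, v) \<partial>lborel" for s]) measurable
  also have "\<dots> = (\<integral>\<^sup>+t. \<integral>\<^sup>+v. \<integral>\<^sup>+x. G (t, x, v) \<partial>lborel \<partial>lborel \<partial>lborel)"
    by (rule nn_integral_lborel_translate[where G="\<lambda>t. \<integral>\<^sup>+v. \<integral>\<^sup>+x. G (t, x, v) \<partial>lborel \<partial>lborel"]) measurable
  also have "\<dots> = (\<integral>\<^sup>+z. G z \<partial>lborel)"
    by (subst nn_integral_pair_lborel, measurable)
       (subst nn_integral_pair_lborel_swap, measurable)
  finally show ?thesis .
qed

text \<open>
  The change of variables from \<open>(a, b)\<close> to position and velocity, done one block at a time so that
  only scalings occur: at fixed \<open>b\<close> the velocity \<open>w\<close> is an affine function of \<open>a\<close> with slope \<open>D\<close>; at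
  fixed \<open>w\<close> the position is an affine function of \<open>b\<close> with slope \<open>E\<close>.
\<close>
lemma nn_integral_traj_endpoint:
  fixes G :: "'n::finite phase \<Rightarrow> ennreal"
  assumes [measurable]: "G \<in> borel_measurable borel" and pos: "r > 0" "\<tau> > 0" "\<sigma> > 0"
  shows "ennreal ((3 / 20 * r ^ 4 * \<tau> * \<sigma> ^ 6) ^ CARD('n)) * (\<integral>\<^sup>+c. G (traj r k \<tau> \<sigma> (t, x, v) c) \<partial>lborel)
    = (\<integral>\<^sup>+y. G (t + r\<^sup>2 * \<sigma> ^ 3 * \<tau>, y) \<partial>lborel)"
proof -
  define T where "T = r\<^sup>2 * \<tau> * \<sigma> ^ 3"
  define D where "D = r * \<sigma>"
  define E where "E = - (3 / 20 * r ^ 3 * \<tau> * \<sigma> ^ 5)"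
  define V where "V b = v + r *\<^sub>R (\<sigma> *\<^sub>R (1 / \<tau>) *\<^sub>R k + \<sigma>\<^sup>2 *\<^sub>R (b - (1 / \<tau>) *\<^sub>R k))" for b :: "real ^ 'n"
  define X where "X w = x + T *\<^sub>R v + (3 / 4 * T) *\<^sub>R (w - v) - E *\<^sub>R (1 / \<tau>) *\<^sub>R k" for w
  have D0: "D > 0" and E0: "E < 0" using pos by (simp_all add: D_def E_def)
  \<comment> \<open>\<open>V b\<close> is the velocity for \<open>a = 0\<close>; \<open>X w\<close> is the position for \<open>b = 0\<close>, expressed through the
    velocity \<open>w\<close> instead of \<open>a\<close>.\<close>
  have traj: "traj r k \<tau> \<sigma> (t, x, v) (a, b) = (t + T, X (V b + D *\<^sub>R a) + E *\<^sub>R b, V b + D *\<^sub>R a)" for a b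
    by (simp add: traj_def Let_def T_def X_def V_def D_def E_def vec_eq_iff)
      (simp add: field_simps power_numeral_reduce)
  have [measurable]: "V \<in> borel_measurable borel" "X \<in> borel_measurable borel"
    by (auto simp: V_def[abs_def] X_def[abs_def] intro!: borel_measurable_continuous_onI continuous_intros)
  have DE: "(3 / 20 * r ^ 4 * \<tau> * \<sigma> ^ 6) ^ CARD('n) = \<bar>E\<bar> ^ CARD('n) * \<bar>D\<bar> ^ CARD('n)"
  proof -
    have "3 / 20 * r ^ 4 * \<tau> * \<sigma> ^ 6 = \<bar>E\<bar> * \<bar>D\<bar>"
      using pos by (simp add: E_def D_def power_numeral_reduce)
    then show ?thesis by (simp add: power_mult_distrib)
  qed
  have "ennreal (\<bar>D\<bar> ^ CARD('n)) * (\<integral>\<^sup>+c. G (traj r k \<tau> \<sigma> (t, x, v) c) \<partial>lborel)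
      = ennreal (\<bar>D\<bar> ^ CARD('n)) * (\<integral>\<^sup>+b. \<integral>\<^sup>+a. G (t + T, X (V b + D *\<^sub>R a) + E *\<^sub>R b, V b + D *\<^sub>R a) \<partial>lborel \<partial>lborel)"
    by (subst nn_integral_pair_lborel_swap, measurable, simp only: traj)
  also have "\<dots> = (\<integral>\<^sup>+b. ennreal (\<bar>D\<bar> ^ CARD('n)) * (\<integral>\<^sup>+a. G (t + T, X (V b + D *\<^sub>R a) + E *\<^sub>R b, V b + D *\<^sub>R a) \<partial>lborel) \<partial>lborel)"
    by (rule nn_integral_cmult[symmetric]) measurable
  also have "\<dots> = (\<integral>\<^sup>+b. \<integral>\<^sup>+w. G (t + T, X w + E *\<^sub>R b, w) \<partial>lborel \<partial>lborel)"
  proof (intro nn_integral_cong)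
    fix b :: "real ^ 'n"
    show "ennreal (\<bar>D\<bar> ^ CARD('n)) * (\<integral>\<^sup>+a. G (t + T, X (V b + D *\<^sub>R a) + E *\<^sub>R b, V b + D *\<^sub>R a) \<partial>lborel)
        = (\<integral>\<^sup>+w. G (t + T, X w + E *\<^sub>R b, w) \<partial>lborel)"
      using nn_integral_lborel_affine[of "\<lambda>w. G (t + T, X w + E *\<^sub>R b, w)" D "V b"] D0 by simp
  qed
  also have "\<dots> = (\<integral>\<^sup>+w. \<integral>\<^sup>+b. G (t + T, X w + E *\<^sub>R b, w) \<partial>lborel \<partial>lborel)"
    by (rule lborel_pair.Fubini') measurable
  finally have 1: "ennreal (\<bar>D\<bar> ^ CARD('n)) * (\<integral>\<^sup>+c. G (traj r k \<tau> \<sigma> (t, x, v) c) \<partial>lborel)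
      = (\<integral>\<^sup>+w. \<integral>\<^sup>+b. G (t + T, X w + E *\<^sub>R b, w) \<partial>lborel \<partial>lborel)" .
  have "ennreal (\<bar>E\<bar> ^ CARD('n)) * (\<integral>\<^sup>+w. \<integral>\<^sup>+b. G (t + T, X w + E *\<^sub>R b, w) \<partial>lborel \<partial>lborel)
      = (\<integral>\<^sup>+w. ennreal (\<bar>E\<bar> ^ CARD('n)) * (\<integral>\<^sup>+b. G (t + T, X w + E *\<^sub>R b, w) \<partial>lborel) \<partial>lborel)"
    by (rule nn_integral_cmult[symmetric]) measurable
  also have "\<dots> = (\<integral>\<^sup>+w. \<integral>\<^sup>+y. G (t + T, y, w) \<partial>lborel \<partial>lborel)"
  proof (intro nn_integral_cong)
    fix w :: "real ^ 'n"
    show "ennreal (\<bar>E\<bar> ^ CARD('n)) * (\<integral>\<^sup>+b. G (t + T, X w + E *\<^sub>R b, w) \<partial>lborel)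
        = (\<integral>\<^sup>+y. G (t + T, y, w) \<partial>lborel)"
      using nn_integral_lborel_affine[of "\<lambda>y. G (t + T, y, w)" E "X w"] E0 by simp
  qed
  also have "\<dots> = (\<integral>\<^sup>+y. G (t + T, y) \<partial>lborel)"
    by (rule nn_integral_pair_lborel_swap[symmetric]) measurable
  finally have 2: "ennreal (\<bar>E\<bar> ^ CARD('n)) * (\<integral>\<^sup>+w. \<integral>\<^sup>+b. G (t + T, X w + E *\<^sub>R b, w) \<partial>lborel \<partial>lborel)
      = (\<integral>\<^sup>+y. G (t + T, y) \<partial>lborel)" .
  have "t + r\<^sup>2 * \<sigma> ^ 3 * \<tau> = t + T" by (simp add: T_def mult_ac)
  then show ?thesis
    unfolding DE by (simp add: ennreal_mult mult.assoc 1 2)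
qed

section \<open>Averages along trajectories\<close>

definition params :: "(real \<times> (real ^ 'n::finite) \<times> (real ^ 'n)) measure" where
  "params = density lborel (indicator ({1..2} \<times> cball 0 1))"

definition unit_interval :: "real measure" where
  "unit_interval = density lborel (indicator {0..1})"

lemma sets_params [simp, measurable_cong]: "sets params = sets borel"
  by (simp add: params_def)

lemma space_params [simp]: "space params = UNIV"
  by (simp add: params_def)

lemma sets_unit_interval [simp, measurable_cong]: "sets unit_interval = sets borel"
  by (simp add: unit_interval_def)

lemma space_unit_interval [simp]: "space unit_interval = UNIV"
  by (simp add: unit_interval_def)

lemma finite_measure_params: "finite_measure (params :: (real \<times> (real ^ 'n::finite) \<times> (real ^ 'n)) measure)"
proof (rule finite_measureI)
  let ?K = "{1..2::real} \<times> cball (0 :: (real ^ 'n) \<times> (real ^ 'n)) 1"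
  have K: "compact ?K" by (intro compact_Times) auto
  then have [measurable]: "?K \<in> sets borel" by (rule borel_compact)
  have "emeasure params (space params :: (real \<times> (real ^ 'n) \<times> (real ^ 'n)) set) = emeasure lborel ?K"
  proof -
    have "emeasure params (space params :: (real \<times> (real ^ 'n) \<times> (real ^ 'n)) set) = (\<integral>\<^sup>+\<omega>. indicator ?K \<omega> * indicator UNIV \<omega> \<partial>lborel)"
      unfolding params_def space_density space_lborel space_borel by (rule emeasure_density) measurable
    then show ?thesis by simp
  qed
  also have "\<dots> < \<infinity>" using K by (rule emeasure_compact_finite)
  finally show "emeasure params (space params :: (real \<times> (real ^ 'n) \<times> (real ^ 'n)) set) \<noteq> \<infinity>" by simp
qed

interpretation params: finite_measure params
  by (rule finite_measure_params)

lemma emeasure_unit_interval: "emeasure unit_interval UNIV = 1"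
  by (simp add: unit_interval_def emeasure_density)

interpretation unit_interval: finite_measure unit_interval
  by (rule finite_measureI) (simp add: emeasure_unit_interval)

lemma AE_unit_interval: "AE \<sigma> in unit_interval. 0 < \<sigma> \<and> \<sigma> \<le> 1"
  unfolding unit_interval_def using AE_lborel_singleton[of "0::real"]
  by (subst AE_density) (auto elim!: eventually_mono split: split_indicator)

lemma nn_integral_params:
  assumes [measurable]: "G \<in> borel_measurable borel"
  shows "(\<integral>\<^sup>+\<omega>. G \<omega> \<partial>params)
    = (\<integral>\<^sup>+\<tau>\<in>{1..2}. (\<integral>\<^sup>+c\<in>cball 0 1. G (\<tau>, c) \<partial>lborel) \<partial>lborel)"
proof -
  have [measurable]: "({1..2::real} \<times> cball (0 :: (real ^ 'n) \<times> (real ^ 'n)) 1) \<in> sets borel"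
    "cball (0 :: (real ^ 'n) \<times> (real ^ 'n)) 1 \<in> sets borel"
    by (auto intro!: borel_compact compact_Times)
  have "(\<integral>\<^sup>+\<omega>. G \<omega> \<partial>params) = (\<integral>\<^sup>+\<omega>. indicator ({1..2} \<times> cball 0 1) \<omega> * G \<omega> \<partial>lborel)"
    unfolding params_def by (subst nn_integral_density) auto
  also have "\<dots> = (\<integral>\<^sup>+\<tau>. \<integral>\<^sup>+c. (G (\<tau>, c) * indicator (cball 0 1) c) * indicator {1..2} \<tau> \<partial>lborel \<partial>lborel)"
    by (subst nn_integral_pair_lborel, measurable) (simp only: indicator_times fst_conv snd_conv mult_ac)
  also have "\<dots> = (\<integral>\<^sup>+\<tau>\<in>{1..2}. (\<integral>\<^sup>+c\<in>cball 0 1. G (\<tau>, c) \<partial>lborel) \<partial>lborel)"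
    by (intro nn_integral_cong nn_integral_multc) measurable
  finally show ?thesis .
qed

text \<open>
  The Jacobian bound for the whole parameter set: \<open>(\<tau>, c)\<close> is mapped to the point on the curve
  through \<open>z\<close>, where \<open>\<tau> \<ge> 1\<close> keeps the determinant of \<open>nn_integral_traj_endpoint\<close> away from zero and
  \<open>\<tau>\<close> itself is rescaled by \<open>r\<^sup>2 \<sigma>\<^sup>3\<close>.
\<close>
lemma nn_integral_params_traj_le:
  fixes G :: "'n::finite phase \<Rightarrow> ennreal"
  assumes [measurable]: "G \<in> borel_measurable borel" and pos: "r > 0" "\<sigma> > 0"
  shows "ennreal ((3 / 20) ^ CARD('n) * r ^ (4 * CARD('n) + 2) * \<sigma> ^ (6 * CARD('n) + 3))
      * (\<integral>\<^sup>+\<omega>. G (traj r k (fst \<omega>) \<sigma> z (snd \<omega>)) \<partial>params) \<le> (\<integral>\<^sup>+y. G y \<partial>lborel)"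
proof -
  obtain t x v where z: "z = (t, x, v)" by (cases z)
  let ?D = "(3 / 20 * r ^ 4 * \<sigma> ^ 6) ^ CARD('n)" and ?s = "r\<^sup>2 * \<sigma> ^ 3"
  define \<Phi> where "\<Phi> s = (\<integral>\<^sup>+y. G (s, y) \<partial>lborel)" for s
  have [measurable]: "cball (0 :: (real ^ 'n) \<times> (real ^ 'n)) 1 \<in> sets borel" by auto
  have [measurable]: "\<Phi> \<in> borel_measurable borel" unfolding \<Phi>_def by measurable
  have s: "?s > 0" using pos by simp
  have le: "ennreal ?D * (\<integral>\<^sup>+c\<in>cball 0 1. G (traj r k \<tau> \<sigma> z c) \<partial>lborel) \<le> \<Phi> (t + ?s * \<tau>)"
    if "\<tau> \<in> {1..2}" for \<tau>
  proof -
    have "3 / 20 * r ^ 4 * \<sigma> ^ 6 * 1 \<le> 3 / 20 * r ^ 4 * \<sigma> ^ 6 * \<tau>"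
      using pos that by (intro mult_left_mono) auto
    then have "3 / 20 * r ^ 4 * \<sigma> ^ 6 \<le> 3 / 20 * r ^ 4 * \<tau> * \<sigma> ^ 6"
      by (simp add: mult_ac)
    then have D: "?D \<le> (3 / 20 * r ^ 4 * \<tau> * \<sigma> ^ 6) ^ CARD('n)"
      using pos by (intro power_mono) auto
    have "ennreal ?D * (\<integral>\<^sup>+c\<in>cball 0 1. G (traj r k \<tau> \<sigma> z c) \<partial>lborel)
        \<le> ennreal ((3 / 20 * r ^ 4 * \<tau> * \<sigma> ^ 6) ^ CARD('n)) * (\<integral>\<^sup>+c. G (traj r k \<tau> \<sigma> z c) \<partial>lborel)"
      using D by (intro mult_mono ennreal_leI nn_integral_mono) (auto split: split_indicator)
    also have "\<dots> = \<Phi> (t + ?s * \<tau>)"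
      unfolding z \<Phi>_def using pos that by (intro nn_integral_traj_endpoint) auto
    finally show ?thesis .
  qed
  have factor: "ennreal ((3 / 20) ^ CARD('n) * r ^ (4 * CARD('n) + 2) * \<sigma> ^ (6 * CARD('n) + 3)) = ennreal ?s * ennreal ?D"
  proof -
    have "?D = (3 / 20) ^ CARD('n) * r ^ (4 * CARD('n)) * \<sigma> ^ (6 * CARD('n))"
      by (simp only: power_mult_distrib power_mult)
    then have "(3 / 20) ^ CARD('n) * r ^ (4 * CARD('n) + 2) * \<sigma> ^ (6 * CARD('n) + 3) = ?s * ?D"
      by (simp only: power_add mult_ac)
    moreover have "ennreal (?s * ?D) = ennreal ?s * ennreal ?D"
      using pos by (intro ennreal_mult) auto
    ultimately show ?thesis by simp
  qed
  define A where "A \<tau> = (\<integral>\<^sup>+c\<in>cball 0 1. G (traj r k \<tau> \<sigma> z c) \<partial>lborel)" for \<tau>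
  have [measurable]: "A \<in> borel_measurable borel" unfolding A_def by measurable
  have "(\<lambda>\<omega>. G (traj r k (fst \<omega>) \<sigma> z (snd \<omega>))) \<in> borel_measurable borel"
    by (intro measurable_compose[OF traj_measurable \<open>G \<in> borel_measurable borel\<close>]
        borel_measurable_continuous_onI continuous_intros measurable_const)
  from nn_integral_params[OF this]
  have int: "(\<integral>\<^sup>+\<omega>. G (traj r k (fst \<omega>) \<sigma> z (snd \<omega>)) \<partial>params) = (\<integral>\<^sup>+\<tau>\<in>{1..2}. A \<tau> \<partial>lborel)"
    by (simp add: A_def)
  have "ennreal ?D * (\<integral>\<^sup>+\<tau>\<in>{1..2}. A \<tau> \<partial>lborel) = (\<integral>\<^sup>+\<tau>. ennreal ?D * (A \<tau> * indicator {1..2} \<tau>) \<partial>lborel)"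
    by (rule nn_integral_cmult[symmetric]) measurable
  also have "\<dots> \<le> (\<integral>\<^sup>+\<tau>. \<Phi> (t + ?s * \<tau>) \<partial>lborel)"
    using le by (intro nn_integral_mono) (auto split: split_indicator simp: A_def)
  finally have "ennreal ?s * (ennreal ?D * (\<integral>\<^sup>+\<tau>\<in>{1..2}. A \<tau> \<partial>lborel)) \<le> ennreal ?s * (\<integral>\<^sup>+\<tau>. \<Phi> (t + ?s * \<tau>) \<partial>lborel)"
    by (rule mult_left_mono) simp
  also have "ennreal ?s * (\<integral>\<^sup>+\<tau>. \<Phi> (t + ?s * \<tau>) \<partial>lborel) = (\<integral>\<^sup>+s. \<Phi> s \<partial>lborel)"
    using nn_integral_lborel_affine[of \<Phi> ?s t] pos by simp
  also have "\<dots> = (\<integral>\<^sup>+y. G y \<partial>lborel)"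
    unfolding \<Phi>_def by (rule nn_integral_pair_lborel[symmetric]) measurable
  finally show ?thesis unfolding int factor mult.assoc[of "ennreal ?s"] .
qed

definition traj_avg :: "real \<Rightarrow> real ^ 'n \<Rightarrow> (real \<Rightarrow> ennreal) \<Rightarrow> ('n::finite phase \<Rightarrow> ennreal) \<Rightarrow> 'n phase \<Rightarrow> ennreal"
  where "traj_avg r k w G z =
    (\<integral>\<^sup>+\<sigma>. w \<sigma> * (\<integral>\<^sup>+\<omega>. G (traj r k (fst \<omega>) \<sigma> z (snd \<omega>)) \<partial>params) \<partial>unit_interval)"

lemma measurable_fst_snd_params [measurable]:
  "fst \<in> borel_measurable params" "snd \<in> measurable params borel"
  by (auto intro!: borel_measurable_continuous_onI continuous_intros cong: measurable_cong_sets)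

lemma traj_avg_measurable [measurable]:
  assumes [measurable]: "G \<in> borel_measurable borel" "w \<in> borel_measurable borel"
  shows "traj_avg r k w G \<in> borel_measurable borel"
  unfolding traj_avg_def[abs_def] by measurable

text \<open>
  The average over \<open>\<sigma>\<close> has total mass one, so a bound that is uniform in \<open>\<sigma>\<close> passes to it with the
  same constant.  The single value \<open>\<sigma> = 0\<close>, at which the curves have not yet left \<open>z\<close>, is negligible.
\<close>
lemma nn_integral_traj_avg_epowr_le:
  fixes G :: "'n::finite phase \<Rightarrow> ennreal"
  assumes p: "1 \<le> p" and [measurable]: "G \<in> borel_measurable borel" "w \<in> borel_measurable borel"
    and I: "\<And>\<sigma>. 0 < \<sigma> \<Longrightarrow> \<sigma> \<le> 1 \<Longrightarrow>
      w \<sigma> epowr p * (\<integral>\<^sup>+z. (\<integral>\<^sup>+\<omega>. G (traj r k (fst \<omega>) \<sigma> z (snd \<omega>)) \<partial>params) epowr p \<partial>lborel) \<le> I"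
  shows "(\<integral>\<^sup>+z. traj_avg r k w G z epowr p \<partial>lborel) \<le> I"
proof -
  have "(\<integral>\<^sup>+z. traj_avg r k w G z epowr p \<partial>lborel) \<le> emeasure unit_interval (space unit_interval) epowr p * I"
    unfolding traj_avg_def
  proof (rule nn_integral_average_epowr_le[OF _ _ p])
    show "AE \<sigma> in unit_interval. (\<integral>\<^sup>+z. (w \<sigma> * (\<integral>\<^sup>+\<omega>. G (traj r k (fst \<omega>) \<sigma> z (snd \<omega>)) \<partial>params)) epowr p \<partial>lborel) \<le> I"
      using AE_unit_interval
    proof eventually_elim
      case (elim \<sigma>)
      then show ?case
        using I[of \<sigma>] by (simp add: epowr_mult nn_integral_cmult)
    qed
  qed (measurable, auto intro: lborel.sigma_finite_measure_axioms unit_interval.finite_measure_axioms)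
  then show ?thesis
    using epowr_ennreal[of 1 p] by (simp add: emeasure_unit_interval)
qed

text \<open>
  Averages of measure preserving images of \<open>g\<close>.  Continuity matters for \<open>p = \<infinity>\<close>, where the essential
  supremum is turned into a pointwise bound.
\<close>
lemma eLp_traj_avg_same_exponent:
  fixes g :: "'n::finite phase \<Rightarrow> real"
  assumes p: "1 \<le> p" and g: "continuous_on UNIV g"
  shows "eLp p lborel (traj_avg r k (\<lambda>_. 1) (\<lambda>z. ennreal (g z)))
    \<le> emeasure (params :: (real \<times> (real ^ 'n) \<times> (real ^ 'n)) measure) UNIV * eLp p lborel (\<lambda>z. ennreal (g z))"
proof (cases rule: exponent_cases[OF p])
  case 1
  let ?S = "esssup lborel (\<lambda>z. ennreal (g z))"
  let ?N = "emeasure (params :: (real \<times> (real ^ 'n) \<times> (real ^ 'n)) measure) UNIV"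
  have [measurable]: "g \<in> borel_measurable borel" using g by (rule borel_measurable_continuous_onI)
  have S: "ennreal (g z) \<le> ?S" for z
    by (rule continuous_le_of_AE_lborel[OF g esssup_AE])
  have "traj_avg r k (\<lambda>_. 1) (\<lambda>z. ennreal (g z)) z \<le> ?N * ?S" for z
  proof -
    have "traj_avg r k (\<lambda>_. 1) (\<lambda>z. ennreal (g z)) z
        \<le> (\<integral>\<^sup>+\<sigma>. 1 * (\<integral>\<^sup>+\<omega>. ?S \<partial>(params :: (real \<times> (real ^ 'n) \<times> (real ^ 'n)) measure)) \<partial>unit_interval)"
      unfolding traj_avg_def by (intro nn_integral_mono mult_left_mono S) auto
    also have "\<dots> = ?N * ?S" by (simp add: emeasure_unit_interval mult.commute)
    finally show ?thesis .
  qed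
  then have "eLp \<infinity> lborel (traj_avg r k (\<lambda>_. 1) (\<lambda>z. ennreal (g z))) \<le> ?N * ?S"
    by (intro eLp_le_const) auto
  then show ?thesis using 1 by (simp add: eLp_def)
next
  case (2 p')
  have [measurable]: "g \<in> borel_measurable borel" using g by (rule borel_measurable_continuous_onI)
  let ?G = "\<lambda>z. ennreal (g z)"
  let ?N = "emeasure (params :: (real \<times> (real ^ 'n) \<times> (real ^ 'n)) measure) UNIV"
  have "(\<integral>\<^sup>+z. (\<integral>\<^sup>+\<omega>. ?G (traj r k (fst \<omega>) \<sigma> z (snd \<omega>)) \<partial>params) epowr p' \<partial>lborel)
      \<le> emeasure (params :: (real \<times> (real ^ 'n) \<times> (real ^ 'n)) measure) (space params) epowr p' * (\<integral>\<^sup>+z. ?G z epowr p' \<partial>lborel)" for \<sigma>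
    by (rule nn_integral_average_epowr_le[OF _ _ 2(1)])
      (use nn_integral_traj[of "\<lambda>z. ?G z epowr p'"] in
        \<open>auto intro: lborel.sigma_finite_measure_axioms params.finite_measure_axioms\<close>)
  then have "(\<integral>\<^sup>+z. traj_avg r k (\<lambda>_. 1) ?G z epowr p' \<partial>lborel) \<le> ?N epowr p' * (\<integral>\<^sup>+z. ?G z epowr p' \<partial>lborel)"
    using 2 epowr_ennreal[of 1 p'] by (intro nn_integral_traj_avg_epowr_le) auto
  then show ?thesis
    using 2 by (simp add: eLp_le_iff epowr_mult nn_integral_epowr_eq)
qed

text \<open>
  The weight \<open>r \<sigma>\<^sup>2\<close> is dominated by the \<open>Q\<close>-th root of the Jacobian, which is \<open>r \<sigma>\<^sup>3\<^sup>/\<^sup>2\<close> up to a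
  constant; the surplus \<open>\<sigma>\<^sup>1\<^sup>/\<^sup>2\<close> is discarded.
\<close>
lemma scale_gain:
  fixes r \<sigma> :: real
  assumes "0 < r" "0 < \<sigma>" "\<sigma> \<le> 1"
  shows "ennreal (r * \<sigma>\<^sup>2) \<le> ennreal (20 / 3)
    * ennreal ((3 / 20) ^ d * r ^ (4 * d + 2) * \<sigma> ^ (6 * d + 3)) epowr (1 / (4 * real d + 2))"
proof -
  let ?n = "4 * d + 2" and ?L = "(3 / 20) ^ d * r ^ (4 * d + 2) * \<sigma> ^ (6 * d + 3)"
  have L: "?L > 0" using assms by simp
  have "(3 / 20 * (r * \<sigma>\<^sup>2)) ^ ?n = (3 / 20) ^ ?n * r ^ ?n * \<sigma> ^ (2 * ?n)"
    by (simp only: power_mult_distrib power_mult mult.assoc)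
  also have "\<dots> \<le> ?L"
    using assms by (intro mult_mono[OF mult_right_mono[OF power_decreasing] power_decreasing]) auto
  finally have le: "(3 / 20 * (r * \<sigma>\<^sup>2)) ^ ?n \<le> ?L" .
  have "3 / 20 * (r * \<sigma>\<^sup>2) = ((3 / 20 * (r * \<sigma>\<^sup>2)) ^ ?n) powr (1 / real ?n)"
  proof -
    have pos: "3 / 20 * (r * \<sigma>\<^sup>2) > 0" using assms by simp
    show ?thesis
      unfolding powr_realpow[OF pos, symmetric] powr_powr using pos by simp
  qed
  also have "\<dots> \<le> ?L powr (1 / real ?n)"
    using le assms by (intro powr_mono2) auto
  finally have "3 / 20 * (r * \<sigma>\<^sup>2) \<le> ?L powr (1 / real ?n)" .
  then have "r * \<sigma>\<^sup>2 \<le> 20 / 3 * ?L powr (1 / (4 * real d + 2))" by (simp add: add.commute)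
  then have "ennreal (r * \<sigma>\<^sup>2) \<le> ennreal (20 / 3 * ?L powr (1 / (4 * real d + 2)))" by (rule ennreal_leI)
  also have "\<dots> = ennreal (20 / 3) * ennreal ?L epowr (1 / (4 * real d + 2))"
    using L by (subst epowr_ennreal) (auto simp: ennreal_mult[symmetric])
  finally show ?thesis .
qed

text \<open>
  The gain of integrability for \<open>S1\<close>.  The Young-type inequality produces the power
  \<open>p/q - 1 = p/Q\<close> of the reciprocal Jacobian, that is the \<open>p\<close>-th power of \<open>r\<^sup>-\<^sup>1 \<sigma>\<^sup>-\<^sup>3\<^sup>/\<^sup>2\<close>, which
  \<open>scale_gain\<close> compensates.  For \<open>p = \<infinity>\<close> one has \<open>q = Q\<close>, and Jensen's inequality at each point suffices.
\<close>
lemma eLp_traj_avg_gain: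
  fixes G :: "'n::finite phase \<Rightarrow> ennreal" and q :: real
  assumes [measurable]: "G \<in> borel_measurable borel" and r: "r > 0" and p: "1 \<le> p" and q: "1 \<le> q"
    and Q: "Q = 4 * real CARD('n) + 2" and pq: "1 / ennreal q = 1 / p + 1 / ennreal Q"
  shows "eLp p lborel (traj_avg r k (\<lambda>\<sigma>. ennreal (r * \<sigma>\<^sup>2)) G)
    \<le> ennreal (20 / 3) * emeasure (params :: (real \<times> (real ^ 'n) \<times> (real ^ 'n)) measure) UNIV epowr (1 - 1 / Q)
      * eLp (ennreal q) lborel G"
proof -
  let ?P = "params :: (real \<times> (real ^ 'n) \<times> (real ^ 'n)) measure"
  let ?N = "emeasure ?P UNIV" and ?X = "eLp (ennreal q) lborel G"
  let ?L = "\<lambda>\<sigma>. ennreal ((3 / 20) ^ CARD('n) * r ^ (4 * CARD('n) + 2) * \<sigma> ^ (6 * CARD('n) + 3))"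
  let ?J = "\<lambda>\<sigma> z. \<integral>\<^sup>+\<omega>. G (traj r k (fst \<omega>) \<sigma> z (snd \<omega>)) epowr q \<partial>params"
  have Q0: "Q > 1" using Q by simp
  have L0: "?L \<sigma> \<noteq> 0" "?L \<sigma> \<noteq> \<infinity>" if "\<sigma> > 0" for \<sigma> using r that by (auto simp: ennreal_eq_0_iff not_le)
  have J: "?J \<sigma> z \<le> ?X epowr q / ?L \<sigma>" if "\<sigma> > 0" for \<sigma> z
  proof -
    have "?L \<sigma> * ?J \<sigma> z \<le> ?X epowr q"
      using nn_integral_params_traj_le[of "\<lambda>y. G y epowr q" r \<sigma> k z] r that q
      by (simp add: nn_integral_epowr_eq)
    then have "?J \<sigma> z * ?L \<sigma> / ?L \<sigma> \<le> ?X epowr q / ?L \<sigma>"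
      by (intro divide_right_mono_ennreal) (simp add: mult.commute)
    then show ?thesis using L0[OF that] by (subst (asm) mult_divide_eq_ennreal) auto
  qed
  \<comment> \<open>Used with \<open>s = p\<close> for finite \<open>p\<close> and with \<open>s = 1\<close> for \<open>p = \<infinity>\<close>.\<close>
  have w: "ennreal (r * \<sigma>\<^sup>2) epowr s * (?X epowr q / ?L \<sigma>) epowr (s / Q) \<le> ennreal (20 / 3) epowr s * ?X epowr (q * s / Q)"
    if "0 < \<sigma>" "\<sigma> \<le> 1" "s \<ge> 0" for \<sigma> s
  proof -
    have "ennreal (r * \<sigma>\<^sup>2) epowr s * (?X epowr q / ?L \<sigma>) epowr (s / Q)
        \<le> (ennreal (20 / 3) * ?L \<sigma> epowr (1 / Q)) epowr s * (?X epowr q / ?L \<sigma>) epowr (s / Q)"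
      using scale_gain[OF r that(1,2), of "CARD('n)"] that(3) Q
      by (intro mult_right_mono epowr_mono) auto
    also have "\<dots> = ennreal (20 / 3) epowr s * (?L \<sigma> * (?X epowr q / ?L \<sigma>)) epowr (s / Q)"
      by (simp only: epowr_mult epowr_epowr mult_ac) (simp add: mult_ac)
    also have "?L \<sigma> * (?X epowr q / ?L \<sigma>) = ?X epowr q"
      using L0[OF that(1)] by (simp add: ennreal_times_divide mult_divide_eq_ennreal mult.commute)
    finally show ?thesis by (simp add: epowr_epowr)
  qed
  show ?thesis
  proof (cases rule: exponent_cases[OF p])
    case 1
    then have "ennreal (1 / q) = ennreal (1 / Q)"
      using pq q Q0 by (simp add: ennreal_1[symmetric] divide_ennreal del: ennreal_1)
    then have qQ: "q = Q" using q Q0 by (simp add: ennreal_inj field_simps)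
    have "traj_avg r k (\<lambda>\<sigma>. ennreal (r * \<sigma>\<^sup>2)) G z \<le> ennreal (20 / 3) * ?N epowr (1 - 1 / Q) * ?X" for z
    proof -
      have "ennreal (r * \<sigma>\<^sup>2) * (\<integral>\<^sup>+\<omega>. G (traj r k (fst \<omega>) \<sigma> z (snd \<omega>)) \<partial>params) \<le> ennreal (20 / 3) * ?N epowr (1 - 1 / Q) * ?X"
        if "0 < \<sigma>" "\<sigma> \<le> 1" for \<sigma>
      proof -
        have "(\<integral>\<^sup>+\<omega>. G (traj r k (fst \<omega>) \<sigma> z (snd \<omega>)) \<partial>?P) epowr q \<le> ?N epowr (q - 1) * ?J \<sigma> z"
          using nn_integral_epowr_Jensen[OF finite_measure_params, of "\<lambda>\<omega>. G (traj r k (fst \<omega>) \<sigma> z (snd \<omega>))" q] q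
          by simp
        also have "\<dots> \<le> ?N epowr (q - 1) * (?X epowr q / ?L \<sigma>)"
          by (intro mult_left_mono J that) auto
        finally have "((\<integral>\<^sup>+\<omega>. G (traj r k (fst \<omega>) \<sigma> z (snd \<omega>)) \<partial>?P) epowr q) epowr (1 / q)
            \<le> (?N epowr (q - 1) * (?X epowr q / ?L \<sigma>)) epowr (1 / q)"
          using q by (intro epowr_mono) auto
        then have "(\<integral>\<^sup>+\<omega>. G (traj r k (fst \<omega>) \<sigma> z (snd \<omega>)) \<partial>?P) \<le> ?N epowr (1 - 1 / Q) * (?X epowr q / ?L \<sigma>) epowr (1 / Q)"
          using q by (simp add: epowr_epowr epowr_mult qQ[symmetric] diff_divide_distrib)
        then have "ennreal (r * \<sigma>\<^sup>2) * (\<integral>\<^sup>+\<omega>. G (traj r k (fst \<omega>) \<sigma> z (snd \<omega>)) \<partial>?P)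
            \<le> ?N epowr (1 - 1 / Q) * (ennreal (r * \<sigma>\<^sup>2) epowr 1 * (?X epowr q / ?L \<sigma>) epowr (1 / Q))"
          by (simp add: mult_left_mono mult.left_commute)
        also have "\<dots> \<le> ?N epowr (1 - 1 / Q) * (ennreal (20 / 3) epowr 1 * ?X epowr (q * 1 / Q))"
          by (intro mult_left_mono w that) auto
        finally show ?thesis using Q0 by (simp add: qQ mult_ac)
      qed
      then have "AE \<sigma> in unit_interval. ennreal (r * \<sigma>\<^sup>2) * (\<integral>\<^sup>+\<omega>. G (traj r k (fst \<omega>) \<sigma> z (snd \<omega>)) \<partial>params)
          \<le> ennreal (20 / 3) * ?N epowr (1 - 1 / Q) * ?X"
        by (intro eventually_mono[OF AE_unit_interval]) blast
      then have "traj_avg r k (\<lambda>\<sigma>. ennreal (r * \<sigma>\<^sup>2)) G z \<le> (\<integral>\<^sup>+\<sigma>. ennreal (20 / 3) * ?N epowr (1 - 1 / Q) * ?X \<partial>unit_interval)"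
        unfolding traj_avg_def by (rule nn_integral_mono_AE)
      then show ?thesis by (simp add: emeasure_unit_interval)
    qed
    then have "eLp \<infinity> lborel (traj_avg r k (\<lambda>\<sigma>. ennreal (r * \<sigma>\<^sup>2)) G)
        \<le> ennreal (20 / 3) * ?N epowr (1 - 1 / Q) * ?X"
      by (intro eLp_le_const) auto
    then show ?thesis using 1 by simp
  next
    case (2 p')
    have "ennreal (1 / q) = ennreal (1 / p' + 1 / Q)"
      using pq q Q0 2 by (simp add: ennreal_1[symmetric] divide_ennreal ennreal_plus[symmetric] del: ennreal_1 ennreal_plus)
    then have e: "1 / q = 1 / p' + 1 / Q" using q Q0 2 by (subst (asm) ennreal_inj) auto
    then have e1: "p' / q - 1 = p' / Q" using 2 q Q0 by (simp add: field_simps)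
    have "p' / Q \<ge> 0" using 2 Q0 by simp
    then have "1 \<le> p' / q" using e1 by simp
    then have qp: "q \<le> p'" using q by simp
    have "ennreal (r * \<sigma>\<^sup>2) epowr p' * (\<integral>\<^sup>+z. (\<integral>\<^sup>+\<omega>. G (traj r k (fst \<omega>) \<sigma> z (snd \<omega>)) \<partial>params) epowr p' \<partial>lborel)
        \<le> (ennreal (20 / 3) * ?N epowr (1 - 1 / Q) * ?X) epowr p'" if "0 < \<sigma>" "\<sigma> \<le> 1" for \<sigma>
    proof -
      have "(\<integral>\<^sup>+z. (\<integral>\<^sup>+\<omega>. G (traj r k (fst \<omega>) \<sigma> z (snd \<omega>)) \<partial>?P) epowr p' \<partial>lborel)
          \<le> emeasure ?P (space ?P) epowr (p' - p' / q + 1) * (?X epowr q / ?L \<sigma>) epowr (p' / q - 1) * (?X epowr q)"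
      proof (rule nn_integral_average_epowr_le_Young[OF lborel.sigma_finite_measure_axioms finite_measure_params q qp])
        show "(\<integral>\<^sup>+z. G (traj r k (fst y) \<sigma> z (snd y)) epowr q \<partial>lborel) \<le> ?X epowr q" for y
          using nn_integral_traj[of "\<lambda>y. G y epowr q" r k "fst y" \<sigma> "snd y"] q by (simp add: nn_integral_epowr_eq)
      qed (use J[OF that(1)] in auto)
      also have "emeasure ?P (space ?P) epowr (p' - p' / q + 1) = ?N epowr (p' - p' / Q)"
        using e1 by (simp add: algebra_simps)
      finally have Young: "(\<integral>\<^sup>+z. (\<integral>\<^sup>+\<omega>. G (traj r k (fst \<omega>) \<sigma> z (snd \<omega>)) \<partial>?P) epowr p' \<partial>lborel)
          \<le> ?N epowr (p' - p' / Q) * (?X epowr q / ?L \<sigma>) epowr (p' / q - 1) * (?X epowr q)" .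
      have ac: "a * (b * c * d) = b * d * (a * c)" for a b c d :: ennreal
        by (simp add: mult_ac)
      have "ennreal (r * \<sigma>\<^sup>2) epowr p' * (\<integral>\<^sup>+z. (\<integral>\<^sup>+\<omega>. G (traj r k (fst \<omega>) \<sigma> z (snd \<omega>)) \<partial>?P) epowr p' \<partial>lborel)
          \<le> ?N epowr (p' - p' / Q) * ?X epowr q * (ennreal (r * \<sigma>\<^sup>2) epowr p' * (?X epowr q / ?L \<sigma>) epowr (p' / Q))"
        using mult_left_mono[OF Young, of "ennreal (r * \<sigma>\<^sup>2) epowr p'"] unfolding e1 ac by simp
      also have "\<dots> \<le> ?N epowr (p' - p' / Q) * ?X epowr q * (ennreal (20 / 3) epowr p' * ?X epowr (q * p' / Q))"
        using 2 that by (intro mult_left_mono w) auto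
      also have "\<dots> = (ennreal (20 / 3) * ?N epowr (1 - 1 / Q) * ?X) epowr p'"
      proof -
        have ac': "a * b * (c * d) = c * a * (b * d)" for a b c d :: ennreal
          by (simp add: mult_ac)
        have "q + q * p' / Q = q * (p' / q)" using e1 by (simp add: algebra_simps)
        then have "?X epowr q * ?X epowr (q * p' / Q) = ?X epowr p'"
          using q by (simp only: epowr_add[symmetric]) simp
        moreover have "(1 - 1 / Q) * p' = p' - p' / Q" by (simp add: left_diff_distrib)
        then have "(ennreal (20 / 3) * ?N epowr (1 - 1 / Q) * ?X) epowr p'
            = ennreal (20 / 3) epowr p' * ?N epowr (p' - p' / Q) * ?X epowr p'"
          by (simp only: epowr_mult epowr_epowr)
        ultimately show ?thesis by (subst ac') (simp only:)
      qed
      finally show ?thesis .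
    qed
    then have "(\<integral>\<^sup>+z. traj_avg r k (\<lambda>\<sigma>. ennreal (r * \<sigma>\<^sup>2)) G z epowr p' \<partial>lborel)
        \<le> (ennreal (20 / 3) * ?N epowr (1 - 1 / Q) * ?X) epowr p'"
      using 2 by (intro nn_integral_traj_avg_epowr_le) auto
    then show ?thesis using 2 by (simp add: eLp_le_iff)
  qed
qed

section \<open>The equation along trajectories\<close>

lemma linear_eq_inner_axis:
  fixes h :: "real ^ 'n::finite \<Rightarrow> real"
  assumes "linear h"
  shows "h x = x \<bullet> (\<chi> i. h (axis i 1))"
proof -
  have "h x = h (\<Sum>i\<in>UNIV. (x $ i) *\<^sub>R axis i 1)"
    by (metis (no_types, lifting) basis_expansion scalar_mult_eq_scaleR sum.cong)
  also have "\<dots> = (\<Sum>i\<in>UNIV. x $ i * h (axis i 1))"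
    using assms by (simp add: linear_sum linear_scale)
  finally show ?thesis by (simp add: inner_vec_def)
qed

lemma has_derivative_phase:
  fixes f :: "'n::finite phase \<Rightarrow> real"
  assumes "f differentiable (at z)"
  shows "(f has_derivative (\<lambda>u. fst u * deriv_t f z + fst (snd u) \<bullet> grad_x f z + snd (snd u) \<bullet> grad_v f z)) (at z)"
proof -
  let ?D = "frechet_derivative f (at z)"
  have D: "(f has_derivative ?D) (at z)"
    using assms by (simp add: frechet_derivative_works)
  then have lin: "linear ?D" by (rule has_derivative_linear)
  have "?D u = fst u * deriv_t f z + fst (snd u) \<bullet> grad_x f z + snd (snd u) \<bullet> grad_v f z" for u
  proof -
    have "u = (fst u *\<^sub>R (1, 0, 0) + (0, fst (snd u), 0)) + (0, 0, snd (snd u))"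
      by (simp add: prod_eq_iff)
    then have "?D u = ?D ((fst u *\<^sub>R (1, 0, 0) + (0, fst (snd u), 0)) + (0, 0, snd (snd u)))"
      by (rule arg_cong)
    also have "\<dots> = fst u * ?D (1, 0, 0) + ?D (0, fst (snd u), 0) + ?D (0, 0, snd (snd u))"
      by (simp only: linear_add[OF lin] linear_scale[OF lin] real_scaleR_def)
    also have "?D (0, fst (snd u), 0) = fst (snd u) \<bullet> grad_x f z"
      unfolding grad_x_def dir_deriv_def
      by (rule linear_eq_inner_axis, rule linear_compose[OF _ lin, of "\<lambda>x. (0, x, 0)", unfolded o_def])
        (auto intro!: linearI)
    also have "?D (0, 0, snd (snd u)) = snd (snd u) \<bullet> grad_v f z"
      unfolding grad_v_def dir_deriv_def
      by (rule linear_eq_inner_axis, rule linear_compose[OF _ lin, of "\<lambda>x. (0, 0, x)", unfolded o_def])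
        (auto intro!: linearI)
    finally show ?thesis by (simp add: deriv_t_def dir_deriv_def)
  qed
  then have "?D = (\<lambda>u. fst u * deriv_t f z + fst (snd u) \<bullet> grad_x f z + snd (snd u) \<bullet> grad_v f z)"
    by (rule ext)
  then show ?thesis using D by metis
qed

text \<open>
  The middle component says that the position moves with the velocity of the curve, measured in
  the time of the curve.
\<close>
lemma traj_has_vector_derivative:
  "((\<lambda>\<sigma>. traj r k \<tau> \<sigma> z c) has_vector_derivative
     (3 * r\<^sup>2 * \<tau> * \<sigma>\<^sup>2, (3 * r\<^sup>2 * \<tau> * \<sigma>\<^sup>2) *\<^sub>R snd (snd (traj r k \<tau> \<sigma> z c)),
      r *\<^sub>R ((fst c + (1 / \<tau>) *\<^sub>R k) + (2 * \<sigma>) *\<^sub>R (snd c - (1 / \<tau>) *\<^sub>R k)))) (at \<sigma>)"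
proof -
  define a b where "a = fst c + (1 / \<tau>) *\<^sub>R k" and "b = snd c - (1 / \<tau>) *\<^sub>R k"
  have scale: "((\<lambda>\<sigma>. g \<sigma> *\<^sub>R w) has_vector_derivative g' *\<^sub>R w) (at \<sigma>)"
    if "(g has_real_derivative g') (at \<sigma>)" for g g' and w :: "real ^ 'a"
    using has_vector_derivative_scaleR[OF that has_vector_derivative_const[of w]] by simp
  have 1: "((\<lambda>\<sigma>. r\<^sup>2 * \<tau> * \<sigma> ^ 3) has_real_derivative 3 * r\<^sup>2 * \<tau> * \<sigma>\<^sup>2) (at \<sigma>)"
    by (auto intro!: derivative_eq_intros)
  have 2: "((\<lambda>\<sigma>. r ^ 3 * \<tau> * (3/4 * \<sigma> ^ 4)) has_real_derivative 3 * r\<^sup>2 * \<tau> * \<sigma>\<^sup>2 * (r * \<sigma>)) (at \<sigma>)"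
    by (auto intro!: derivative_eq_intros simp: power_numeral_reduce)
  have 3: "((\<lambda>\<sigma>. r ^ 3 * \<tau> * (3/5 * \<sigma> ^ 5)) has_real_derivative 3 * r\<^sup>2 * \<tau> * \<sigma>\<^sup>2 * (r * \<sigma>\<^sup>2)) (at \<sigma>)"
    by (auto intro!: derivative_eq_intros simp: power_numeral_reduce)
  have 4: "((\<lambda>\<sigma>. r * \<sigma>) has_real_derivative r) (at \<sigma>)"
    "((\<lambda>\<sigma>. r * \<sigma>\<^sup>2) has_real_derivative r * (2 * \<sigma>)) (at \<sigma>)"
    by (auto intro!: derivative_eq_intros)
  have traj: "(\<lambda>\<sigma>. traj r k \<tau> \<sigma> z c) = (\<lambda>\<sigma>. (fst z + r\<^sup>2 * \<tau> * \<sigma> ^ 3,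
      fst (snd z) + ((r\<^sup>2 * \<tau> * \<sigma> ^ 3) *\<^sub>R snd (snd z)
        + ((r ^ 3 * \<tau> * (3/4 * \<sigma> ^ 4)) *\<^sub>R a + (r ^ 3 * \<tau> * (3/5 * \<sigma> ^ 5)) *\<^sub>R b)),
      snd (snd z) + ((r * \<sigma>) *\<^sub>R a + (r * \<sigma>\<^sup>2) *\<^sub>R b)))"
    by (simp add: traj_def Let_def a_def b_def scaleR_right_distrib add.assoc mult.assoc)
  have "((\<lambda>\<sigma>. traj r k \<tau> \<sigma> z c) has_vector_derivative
     (0 + 3 * r\<^sup>2 * \<tau> * \<sigma>\<^sup>2, 0 + ((3 * r\<^sup>2 * \<tau> * \<sigma>\<^sup>2) *\<^sub>R snd (snd z)
        + ((3 * r\<^sup>2 * \<tau> * \<sigma>\<^sup>2 * (r * \<sigma>)) *\<^sub>R a + (3 * r\<^sup>2 * \<tau> * \<sigma>\<^sup>2 * (r * \<sigma>\<^sup>2)) *\<^sub>R b)),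
      0 + (r *\<^sub>R a + (r * (2 * \<sigma>)) *\<^sub>R b))) (at \<sigma>)"
    unfolding traj
    by (intro has_vector_derivative_Pair has_vector_derivative_add has_vector_derivative_const scale 1 2 3 4
        has_real_derivative_iff_has_vector_derivative[THEN iffD1])
  moreover have "(0 + 3 * r\<^sup>2 * \<tau> * \<sigma>\<^sup>2, 0 + ((3 * r\<^sup>2 * \<tau> * \<sigma>\<^sup>2) *\<^sub>R snd (snd z)
        + ((3 * r\<^sup>2 * \<tau> * \<sigma>\<^sup>2 * (r * \<sigma>)) *\<^sub>R a + (3 * r\<^sup>2 * \<tau> * \<sigma>\<^sup>2 * (r * \<sigma>\<^sup>2)) *\<^sub>R b)),
      0 + (r *\<^sub>R a + (r * (2 * \<sigma>)) *\<^sub>R b))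
    = (3 * r\<^sup>2 * \<tau> * \<sigma>\<^sup>2, (3 * r\<^sup>2 * \<tau> * \<sigma>\<^sup>2) *\<^sub>R snd (snd (traj r k \<tau> \<sigma> z c)), r *\<^sub>R (a + (2 * \<sigma>) *\<^sub>R b))"
    by (simp add: traj_def Let_def a_def b_def scaleR_right_distrib)
  ultimately show ?thesis by (simp add: a_def b_def)
qed

text \<open>
  The derivatives in time and position enter only through the transport operator.
\<close>
lemma derivative_along_traj:
  fixes f :: "'n::finite phase \<Rightarrow> real"
  assumes diff: "\<And>z. f differentiable (at z)"
    and eq: "\<And>t x v. deriv_t f (t, x, v) + v \<bullet> grad_x f (t, x, v) = g (t, x, v)"
  shows "((\<lambda>\<sigma>. f (traj r k \<tau> \<sigma> z c)) has_vector_derivative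
    3 * r\<^sup>2 * \<tau> * \<sigma>\<^sup>2 * g (traj r k \<tau> \<sigma> z c)
    + r * (((fst c + (1 / \<tau>) *\<^sub>R k) + (2 * \<sigma>) *\<^sub>R (snd c - (1 / \<tau>) *\<^sub>R k)) \<bullet> grad_v f (traj r k \<tau> \<sigma> z c))) (at \<sigma>)"
proof -
  let ?y = "traj r k \<tau> \<sigma> z c"
  have eq': "deriv_t f ?y + snd (snd ?y) \<bullet> grad_x f ?y = g ?y"
    using eq[of "fst ?y" "fst (snd ?y)" "snd (snd ?y)"] by simp
  have "((\<lambda>\<sigma>. f (traj r k \<tau> \<sigma> z c)) has_vector_derivative
     3 * r\<^sup>2 * \<tau> * \<sigma>\<^sup>2 * deriv_t f ?y + ((3 * r\<^sup>2 * \<tau> * \<sigma>\<^sup>2) *\<^sub>R snd (snd ?y)) \<bullet> grad_x f ?y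
      + (r *\<^sub>R ((fst c + (1 / \<tau>) *\<^sub>R k) + (2 * \<sigma>) *\<^sub>R (snd c - (1 / \<tau>) *\<^sub>R k))) \<bullet> grad_v f ?y) (at \<sigma>)"
    using has_derivative_compose[OF traj_has_vector_derivative[of r k \<tau> z c \<sigma>, unfolded has_vector_derivative_def]
        has_derivative_phase[OF diff[of ?y]]]
    unfolding has_vector_derivative_def by (simp add: algebra_simps)
  also have "3 * r\<^sup>2 * \<tau> * \<sigma>\<^sup>2 * deriv_t f ?y + ((3 * r\<^sup>2 * \<tau> * \<sigma>\<^sup>2) *\<^sub>R snd (snd ?y)) \<bullet> grad_x f ?y
      = 3 * r\<^sup>2 * \<tau> * \<sigma>\<^sup>2 * g ?y"
    by (simp add: eq'[symmetric] algebra_simps)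
  finally show ?thesis by simp
qed

lemma Basis_phase: "(0, 0, axis i 1) \<in> (Basis :: ('n::finite phase) set)"
  by (simp add: Basis_prod_def axis_in_Basis_iff)

lemma grad_v_continuous:
  fixes f :: "'n::finite phase \<Rightarrow> real"
  assumes "f \<in> schwartz"
  shows "continuous_on UNIV (grad_v f)"
proof -
  have "continuous_on UNIV (\<lambda>z. \<chi> i. dir_deriv (0, 0, axis i 1) f z)"
    using schwartz_dir_deriv_continuous[OF assms Basis_phase] by (intro continuous_on_vec_lambda)
  then show ?thesis by (simp add: grad_v_def[abs_def])
qed

lemma component_differentiable:
  fixes S :: "'n::finite phase \<Rightarrow> real ^ 'n"
  assumes "S \<in> schwartz"
  shows "(\<lambda>w. S w $ i) differentiable (at z)"
    and "dir_deriv u (\<lambda>w. S w $ i) z = dir_deriv u S z $ i"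
proof -
  have "(S has_derivative frechet_derivative S (at z)) (at z)"
    using schwartz_differentiable[OF assms] by (simp add: frechet_derivative_works)
  then have D: "((\<lambda>w. S w $ i) has_derivative (\<lambda>u. frechet_derivative S (at z) u $ i)) (at z)"
    by (rule bounded_linear.has_derivative[OF bounded_linear_vec_nth])
  then show "(\<lambda>w. S w $ i) differentiable (at z)" by (auto simp: differentiable_def)
  show "dir_deriv u (\<lambda>w. S w $ i) z = dir_deriv u S z $ i"
    unfolding dir_deriv_def using fun_cong[OF frechet_derivative_at[OF D], of u] by (rule sym)
qed

lemma component_dir_deriv_continuous:
  fixes S :: "'n::finite phase \<Rightarrow> real ^ 'n"
  assumes "S \<in> schwartz"
  shows "continuous_on UNIV (dir_deriv (0, 0, axis j 1) (\<lambda>w. S w $ i))"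
  using schwartz_dir_deriv_continuous[OF assms Basis_phase[of j]]
  by (simp add: component_differentiable(2)[OF assms] continuous_on_component cong: continuous_on_cong)

lemma div_v_continuous:
  fixes S :: "'n::finite phase \<Rightarrow> real ^ 'n"
  assumes "S \<in> schwartz"
  shows "continuous_on UNIV (div_v S)"
  unfolding div_v_def[abs_def]
  by (intro continuous_on_sum component_dir_deriv_continuous[OF assms])

text \<open>
  Each partial derivative of \<open>S\<close> in the velocity is, by \<open>traj_shift_velocity\<close>, a derivative of
  \<open>c \<mapsto> S (traj \<dots> c)\<close>.  The direction has components \<open>- 4 / (r \<sigma>)\<close> and \<open>5 / (r \<sigma>\<^sup>2)\<close>; the prefactor
  \<open>r \<sigma>\<^sup>2\<close>, which comes from the derivative of time, makes the result bounded down to \<open>\<sigma> = 0\<close>.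
\<close>
lemma integral_div_v_traj:
  fixes S :: "'n::finite phase \<Rightarrow> real ^ 'n"
  assumes S: "S \<in> schwartz" and pos: "r > 0" "\<sigma> > 0"
  shows "r * \<sigma>\<^sup>2 * (\<integral>c. div_v S (traj r k \<tau> \<sigma> z c) * bump c \<partial>lborel)
    = (\<integral>c. 4 * max 0 (1 - c \<bullet> c) * ((5 *\<^sub>R snd c - (4 * \<sigma>) *\<^sub>R fst c) \<bullet> S (traj r k \<tau> \<sigma> z c)) \<partial>lborel)"
proof -
  let ?T = "traj r k \<tau> \<sigma> z"
  define u where "u i = (- (4 / (r * \<sigma>)) *\<^sub>R axis i 1 :: real ^ 'n, (5 / (r * \<sigma>\<^sup>2)) *\<^sub>R axis i 1 :: real ^ 'n)" for i
  let ?d = "\<lambda>i c. dir_deriv (0, 0, axis i 1) (\<lambda>w. S w $ i) (?T c)"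
  let ?m = "\<lambda>c :: (real ^ 'n) \<times> (real ^ 'n). 4 * max 0 (1 - c \<bullet> c)"
  have contS: "continuous_on UNIV (\<lambda>c. S (?T c))"
    by (intro continuous_on_compose2[OF schwartz_continuous[OF S]] continuous_intros) auto
  have contd: "continuous_on UNIV (?d i)" for i
    by (intro continuous_on_compose2[OF component_dir_deriv_continuous[OF S]] continuous_intros) auto
  have parts: "(\<integral>c. ?d i c * bump c \<partial>lborel) = (\<integral>c. S (?T c) $ i * (?m c * (c \<bullet> u i)) \<partial>lborel)" for i
  proof (rule integration_by_parts_bump)
    show "((\<lambda>e. S (?T (c + e *\<^sub>R u i)) $ i) has_real_derivative ?d i c) (at 0)" for c
      unfolding u_def traj_shift_velocity[OF pos]
      by (rule has_real_derivative_dir_deriv) (rule component_differentiable(1)[OF S])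
  qed (intro continuous_on_component contS contd)+
  have inner: "r * \<sigma>\<^sup>2 * (c \<bullet> u i) = 5 * snd c $ i - 4 * \<sigma> * fst c $ i" for c i
    using pos by (cases c) (simp add: u_def inner_axis field_simps power2_eq_square)
  have int2: "integrable lborel (\<lambda>c. S (?T c) $ i * (?m c * (c \<bullet> u i)))" for i
    by (intro integrable_compact_support[where S="cball 0 1"])
      (auto intro!: continuous_intros continuous_on_component contS simp: max_0_outside_ball)
  have "r * \<sigma>\<^sup>2 * (\<integral>c. div_v S (?T c) * bump c \<partial>lborel)
      = r * \<sigma>\<^sup>2 * (\<integral>c. (\<Sum>i\<in>UNIV. ?d i c * bump c) \<partial>lborel)"
    by (simp add: div_v_def sum_distrib_right)
  also have "\<dots> = r * \<sigma>\<^sup>2 * (\<Sum>i\<in>UNIV. (\<integral>c. ?d i c * bump c \<partial>lborel))"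
    by (subst Bochner_Integration.integral_sum) (auto intro!: integrable_bump_mult contd)
  also have "\<dots> = r * \<sigma>\<^sup>2 * (\<integral>c. (\<Sum>i\<in>UNIV. S (?T c) $ i * (?m c * (c \<bullet> u i))) \<partial>lborel)"
    unfolding parts by (subst Bochner_Integration.integral_sum) (auto intro!: int2)
  also have "\<dots> = (\<integral>c. r * \<sigma>\<^sup>2 * (\<Sum>i\<in>UNIV. S (?T c) $ i * (?m c * (c \<bullet> u i))) \<partial>lborel)"
    by simp
  also have "\<dots> = (\<integral>c. ?m c * ((5 *\<^sub>R snd c - (4 * \<sigma>) *\<^sub>R fst c) \<bullet> S (?T c)) \<partial>lborel)"
  proof (rule Bochner_Integration.integral_cong[OF refl])
    fix c :: "(real ^ 'n) \<times> (real ^ 'n)"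
    have "r * \<sigma>\<^sup>2 * (\<Sum>i\<in>UNIV. S (?T c) $ i * (?m c * (c \<bullet> u i)))
        = (\<Sum>i\<in>UNIV. ?m c * ((r * \<sigma>\<^sup>2 * (c \<bullet> u i)) * S (?T c) $ i))"
      by (simp add: sum_distrib_left mult_ac)
    also have "\<dots> = ?m c * ((5 *\<^sub>R snd c - (4 * \<sigma>) *\<^sub>R fst c) \<bullet> S (?T c))"
      by (simp only: inner) (simp add: inner_vec_def sum_distrib_left)
    finally show "r * \<sigma>\<^sup>2 * (\<Sum>i\<in>UNIV. S (?T c) $ i * (?m c * (c \<bullet> u i)))
        = ?m c * ((5 *\<^sub>R snd c - (4 * \<sigma>) *\<^sub>R fst c) \<bullet> S (?T c))" .
  qed
  finally show ?thesis .
qed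

section \<open>Pointwise bound for the increment\<close>

lemma traj_coefficient_bounds:
  fixes c :: "(real ^ 'n::finite) \<times> (real ^ 'n)"
  assumes c: "norm c \<le> 1" and k: "norm k \<le> 20 / 3" and t: "1 \<le> \<tau>" and s: "0 \<le> \<sigma>" "\<sigma> \<le> 1"
  shows "norm ((fst c + (1 / \<tau>) *\<^sub>R k) + (2 * \<sigma>) *\<^sub>R (snd c - (1 / \<tau>) *\<^sub>R k)) \<le> 23"
    and "norm (5 *\<^sub>R snd c - (4 * \<sigma>) *\<^sub>R fst c) \<le> 9"
proof -
  have f: "norm (fst c) \<le> 1" "norm (snd c) \<le> 1"
    using c norm_fst_le[of "fst c" "snd c"] norm_snd_le[of "snd c" "fst c"] by auto
  have "norm ((1 / \<tau>) *\<^sub>R k) \<le> 1 * (20 / 3)"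
    unfolding norm_scaleR using t k by (intro mult_mono) auto
  then have ab: "norm (fst c + (1 / \<tau>) *\<^sub>R k) \<le> 23 / 3" "norm (snd c - (1 / \<tau>) *\<^sub>R k) \<le> 23 / 3"
    using f norm_triangle_ineq[of "fst c" "(1 / \<tau>) *\<^sub>R k"] norm_triangle_ineq4[of "snd c" "(1 / \<tau>) *\<^sub>R k"]
    by linarith+
  have "norm ((2 * \<sigma>) *\<^sub>R (snd c - (1 / \<tau>) *\<^sub>R k)) \<le> 2 * (23 / 3)"
    unfolding norm_scaleR using s ab by (intro mult_mono) auto
  then show "norm ((fst c + (1 / \<tau>) *\<^sub>R k) + (2 * \<sigma>) *\<^sub>R (snd c - (1 / \<tau>) *\<^sub>R k)) \<le> 23"
    using ab norm_triangle_ineq[of "fst c + (1 / \<tau>) *\<^sub>R k" "(2 * \<sigma>) *\<^sub>R (snd c - (1 / \<tau>) *\<^sub>R k)"] by linarith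
  have "norm ((4 * \<sigma>) *\<^sub>R fst c) \<le> 4 * 1"
    unfolding norm_scaleR using s f by (intro mult_mono) auto
  moreover have "norm (5 *\<^sub>R snd c) \<le> 5" using f by simp
  ultimately show "norm (5 *\<^sub>R snd c - (4 * \<sigma>) *\<^sub>R fst c) \<le> 9"
    using norm_triangle_ineq4[of "5 *\<^sub>R snd c" "(4 * \<sigma>) *\<^sub>R fst c"] by linarith
qed

lemma integral_norm_bound_nn:
  fixes g :: "'a \<Rightarrow> real"
  shows "ennreal \<bar>\<integral>x. g x \<partial>M\<bar> \<le> (\<integral>\<^sup>+x. ennreal \<bar>g x\<bar> \<partial>M)"
proof (cases "integrable M g")
  case True
  then show ?thesis using integral_norm_bound_ennreal[OF True] by simp
qed (simp add: not_integrable_integral_eq)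

lemma nn_integral_unit_interval:
  assumes [measurable]: "g \<in> borel_measurable borel"
  shows "(\<integral>\<^sup>+\<sigma>. g \<sigma> \<partial>unit_interval) = (\<integral>\<^sup>+\<sigma>. indicator {0..1} \<sigma> * g \<sigma> \<partial>lborel)"
  unfolding unit_interval_def by (subst nn_integral_density) auto

text \<open>
  Integrate the derivative of \<open>f\<close> along the curves over \<open>\<sigma>\<close>, average over \<open>c\<close>, interchange the
  integrals and integrate by parts in the term with the divergence.  The resulting integrand \<open>R\<close>
  contains no derivative of \<open>S0\<close>; the constant \<open>216 = 3 \<cdot> 2 \<cdot> 4 \<cdot> 9\<close> is that of the \<open>S0\<close> term and
  exceeds the other two.
\<close>
lemma bump_average_deviation_le:
  fixes f S1 :: "'n::finite phase \<Rightarrow> real" and S0 :: "'n phase \<Rightarrow> real ^ 'n"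
  assumes f: "f \<in> schwartz" and S0: "S0 \<in> schwartz" and S1: "S1 \<in> schwartz"
    and eq: "\<And>t x v. deriv_t f (t, x, v) + v \<bullet> grad_x f (t, x, v) = div_v S0 (t, x, v) + S1 (t, x, v)"
    and r: "r > 0" and t: "1 \<le> \<tau>" "\<tau> \<le> 2" and k: "norm k \<le> 20 / 3"
  shows "ennreal \<bar>\<integral>c. (f (traj r k \<tau> 1 z c) - f z) * bump c \<partial>lborel\<bar>
    \<le> (\<integral>\<^sup>+\<sigma>. (\<integral>\<^sup>+c\<in>cball 0 1. ennreal (216 * r) *
        (ennreal (norm (S0 (traj r k \<tau> \<sigma> z c))) + ennreal (norm (grad_v f (traj r k \<tau> \<sigma> z c)))
         + ennreal (r * \<sigma>\<^sup>2) * ennreal (norm (S1 (traj r k \<tau> \<sigma> z c)))) \<partial>lborel) \<partial>unit_interval)"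
proof -
  let ?T = "traj r k \<tau>"
  let ?B = "cball 0 1 :: ((real ^ 'n) \<times> (real ^ 'n)) set"
  define A where "A \<sigma> c = (fst c + (1 / \<tau>) *\<^sub>R k) + (2 * \<sigma>) *\<^sub>R (snd c - (1 / \<tau>) *\<^sub>R k)"
    for \<sigma> and c :: "(real ^ 'n) \<times> (real ^ 'n)"
  define H where "H \<sigma> c = 3 * r\<^sup>2 * \<tau> * \<sigma>\<^sup>2 * (div_v S0 (?T \<sigma> z c) + S1 (?T \<sigma> z c))
    + r * (A \<sigma> c \<bullet> grad_v f (?T \<sigma> z c))" for \<sigma> c
  define R where "R \<sigma> c = 3 * r\<^sup>2 * \<tau> * \<sigma>\<^sup>2 * S1 (?T \<sigma> z c) * bump c
    + r * (A \<sigma> c \<bullet> grad_v f (?T \<sigma> z c)) * bump c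
    + 3 * r * \<tau> * (4 * max 0 (1 - c \<bullet> c) * ((5 *\<^sub>R snd c - (4 * \<sigma>) *\<^sub>R fst c) \<bullet> S0 (?T \<sigma> z c)))" for \<sigma> c
  define b where "b \<sigma> y = ennreal (216 * r) * (ennreal (norm (S0 y)) + ennreal (norm (grad_v f y))
    + ennreal (r * \<sigma>\<^sup>2) * ennreal (norm (S1 y)))" for \<sigma> y
  note cont = schwartz_continuous[OF f] schwartz_continuous[OF S0] schwartz_continuous[OF S1]
    grad_v_continuous[OF f] div_v_continuous[OF S0]
  note cont2 = cont[THEN continuous_on_compose2]
  have [measurable]: "f \<in> borel_measurable borel" "S0 \<in> borel_measurable borel" "S1 \<in> borel_measurable borel"
    "grad_v f \<in> borel_measurable borel"
    using cont by (auto intro: borel_measurable_continuous_onI)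
  have [measurable]: "?B \<in> sets borel" by auto
  have contH: "continuous_on UNIV (\<lambda>w. H (fst w) (snd w))"
    unfolding H_def A_def by (intro continuous_intros cont2(3-5)) auto
  have contHs: "continuous_on X (\<lambda>\<sigma>. H \<sigma> c)" for c X
  proof -
    have "continuous_on X (\<lambda>\<sigma>. (\<sigma>, c))"
      by (rule continuous_on_Pair) (rule continuous_on_id, rule continuous_on_const)
    from continuous_on_compose2[OF contH this] show ?thesis by simp
  qed
  have FTC: "(\<integral>\<sigma>. indicator {0..1} \<sigma> *\<^sub>R H \<sigma> c \<partial>lborel) = f (?T 1 z c) - f z" for c
  proof -
    have "((\<lambda>\<sigma>. f (?T \<sigma> z c)) has_vector_derivative H \<sigma> c) (at \<sigma>)" for \<sigma>
      unfolding H_def A_def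
      by (rule derivative_along_traj[where g="\<lambda>y. div_v S0 y + S1 y"])
        (use schwartz_differentiable[OF f] eq in auto)
    then have "(\<integral>\<sigma>. indicator {0..1} \<sigma> *\<^sub>R H \<sigma> c \<partial>lborel) = f (?T 1 z c) - f (?T 0 z c)"
      by (intro integral_FTC_Icc contHs) (auto intro: has_vector_derivative_at_within)
    then show ?thesis by simp
  qed
  have intH: "integrable (lborel \<Otimes>\<^sub>M lborel) (\<lambda>(\<sigma>, c). indicator {0..1} \<sigma> *\<^sub>R H \<sigma> c * bump c)"
  proof -
    have "integrable lborel (\<lambda>w. indicator ({0..1} \<times> ?B) w *\<^sub>R (H (fst w) (snd w) * bump (snd w)))"
      by (intro borel_integrable_compact compact_Times continuous_intros continuous_on_subset[OF contH]) auto
    also have "(\<lambda>w. indicator ({0..1} \<times> ?B) w *\<^sub>R (H (fst w) (snd w) * bump (snd w)))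
        = (\<lambda>(\<sigma>, c). indicator {0..1} \<sigma> *\<^sub>R H \<sigma> c * bump c)"
      by (auto simp: fun_eq_iff indicator_def bump_eq_0)
    finally show ?thesis by (simp add: lborel_prod)
  qed
  have "(\<integral>c. (f (?T 1 z c) - f z) * bump c \<partial>lborel)
      = (\<integral>c. (\<integral>\<sigma>. indicator {0..1} \<sigma> *\<^sub>R H \<sigma> c * bump c \<partial>lborel) \<partial>lborel)"
    by (simp only: FTC[symmetric] integral_mult_left_zero)
  also have "\<dots> = (\<integral>\<sigma>. (\<integral>c. indicator {0..1} \<sigma> *\<^sub>R H \<sigma> c * bump c \<partial>lborel) \<partial>lborel)"
    using lborel_pair.Fubini_integral[OF intH] by simp
  also have "\<dots> = (\<integral>\<sigma>. indicator {0..1} \<sigma> * (\<integral>c. H \<sigma> c * bump c \<partial>lborel) \<partial>lborel)"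
    by (simp add: mult.assoc)
  finally have dev: "(\<integral>c. (f (?T 1 z c) - f z) * bump c \<partial>lborel)
      = (\<integral>\<sigma>. indicator {0..1} \<sigma> * (\<integral>c. H \<sigma> c * bump c \<partial>lborel) \<partial>lborel)" .
  have HR: "(\<integral>c. H \<sigma> c * bump c \<partial>lborel) = (\<integral>c. R \<sigma> c \<partial>lborel)" if "\<sigma> > 0" for \<sigma>
  proof -
    let ?s = "\<lambda>c. 3 * r\<^sup>2 * \<tau> * \<sigma>\<^sup>2 * S1 (?T \<sigma> z c) * bump c"
    let ?v = "\<lambda>c. r * (A \<sigma> c \<bullet> grad_v f (?T \<sigma> z c)) * bump c"
    let ?d = "\<lambda>c. div_v S0 (?T \<sigma> z c) * bump c"
    let ?e = "\<lambda>c. 4 * max 0 (1 - c \<bullet> c) * ((5 *\<^sub>R snd c - (4 * \<sigma>) *\<^sub>R fst c) \<bullet> S0 (?T \<sigma> z c))"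
    have int: "integrable lborel ?s" "integrable lborel ?v" "integrable lborel ?d"
      unfolding A_def by (intro integrable_bump_mult continuous_intros cont2(3-5); auto)+
    have inte: "integrable lborel ?e"
      by (intro integrable_compact_support[where S="?B"])
        (auto intro!: continuous_intros cont2(2) simp: max_0_outside_ball)
    have lin: "(\<integral>c. s c + v c + a * e c \<partial>lborel)
        = (\<integral>c. s c \<partial>lborel) + (\<integral>c. v c \<partial>lborel) + a * (\<integral>c. e c \<partial>lborel)"
      if "integrable lborel s" "integrable lborel v" "integrable lborel e"
      for a :: real and s v e :: "(real ^ 'n) \<times> (real ^ 'n) \<Rightarrow> real"
      using that by simp
    have "(\<integral>c. H \<sigma> c * bump c \<partial>lborel) = (\<integral>c. ?s c + ?v c + 3 * r * \<tau> * (r * \<sigma>\<^sup>2) * ?d c \<partial>lborel)"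
      by (intro Bochner_Integration.integral_cong) (simp_all add: H_def algebra_simps power2_eq_square)
    also have "\<dots> = (\<integral>c. ?s c \<partial>lborel) + (\<integral>c. ?v c \<partial>lborel) + 3 * r * \<tau> * (r * \<sigma>\<^sup>2 * (\<integral>c. ?d c \<partial>lborel))"
      by (subst lin[OF int]) (simp add: mult.assoc)
    also have "r * \<sigma>\<^sup>2 * (\<integral>c. ?d c \<partial>lborel) = (\<integral>c. ?e c \<partial>lborel)"
      by (rule integral_div_v_traj[OF S0 r that])
    also have "(\<integral>c. ?s c \<partial>lborel) + (\<integral>c. ?v c \<partial>lborel) + 3 * r * \<tau> * (\<integral>c. ?e c \<partial>lborel)
        = (\<integral>c. R \<sigma> c \<partial>lborel)"
      unfolding R_def by (rule lin[OF int(1,2) inte, symmetric])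
    finally show ?thesis .
  qed
  have Rb: "ennreal \<bar>R \<sigma> c\<bar> \<le> b \<sigma> (?T \<sigma> z c) * indicator ?B c" if s: "0 \<le> \<sigma>" "\<sigma> \<le> 1" for \<sigma> c
  proof (cases "norm c \<le> 1")
    case False
    then show ?thesis by (simp add: R_def bump_eq_0 max_0_outside_ball)
  next
    case True
    let ?y = "?T \<sigma> z c"
    note coef = traj_coefficient_bounds[OF True k t(1) s, folded A_def]
    have "\<bar>3 * r\<^sup>2 * \<tau> * \<sigma>\<^sup>2 * S1 ?y * bump c\<bar> = (3 * r * \<tau>) * (r * \<sigma>\<^sup>2 * \<bar>S1 ?y\<bar>) * bump c"
      using r t bump_nonneg[of c] by (simp add: abs_mult power2_eq_square)
    also have "\<dots> \<le> (216 * r) * (r * \<sigma>\<^sup>2 * \<bar>S1 ?y\<bar>) * 1"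
      using r t bump_nonneg[of c] bump_le_1[of c] mult_left_mono[of \<tau> 72 "3 * r"]
      by (intro mult_mono[OF mult_right_mono]) auto
    finally have 1: "\<bar>3 * r\<^sup>2 * \<tau> * \<sigma>\<^sup>2 * S1 ?y * bump c\<bar> \<le> 216 * r * (r * \<sigma>\<^sup>2 * norm (S1 ?y))" by simp
    have "\<bar>A \<sigma> c \<bullet> grad_v f ?y\<bar> \<le> 23 * norm (grad_v f ?y)"
      using Cauchy_Schwarz_ineq2 mult_right_mono[OF coef(1) norm_ge_zero] by (rule order_trans)
    then have "\<bar>r * (A \<sigma> c \<bullet> grad_v f ?y) * bump c\<bar> \<le> r * (216 * norm (grad_v f ?y)) * 1"
      using r bump_nonneg[of c] bump_le_1[of c] unfolding abs_mult
      by (intro mult_mono) (auto intro: order_trans[OF _ mult_right_mono])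
    then have 2: "\<bar>r * (A \<sigma> c \<bullet> grad_v f ?y) * bump c\<bar> \<le> 216 * r * norm (grad_v f ?y)" by simp
    have "\<bar>(5 *\<^sub>R snd c - (4 * \<sigma>) *\<^sub>R fst c) \<bullet> S0 ?y\<bar> \<le> 9 * norm (S0 ?y)"
      using Cauchy_Schwarz_ineq2 mult_right_mono[OF coef(2) norm_ge_zero] by (rule order_trans)
    then have "\<bar>3 * r * \<tau> * (4 * max 0 (1 - c \<bullet> c) * ((5 *\<^sub>R snd c - (4 * \<sigma>) *\<^sub>R fst c) \<bullet> S0 ?y))\<bar>
        \<le> 3 * r * 2 * (4 * 1 * (9 * norm (S0 ?y)))"
      unfolding abs_mult using r t by (intro mult_mono) auto
    then have 3: "\<bar>3 * r * \<tau> * (4 * max 0 (1 - c \<bullet> c) * ((5 *\<^sub>R snd c - (4 * \<sigma>) *\<^sub>R fst c) \<bullet> S0 ?y))\<bar>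
        \<le> 216 * r * norm (S0 ?y)" by simp
    have "\<bar>R \<sigma> c\<bar> \<le> 216 * r * (norm (S0 ?y) + norm (grad_v f ?y) + r * \<sigma>\<^sup>2 * norm (S1 ?y))"
      unfolding R_def distrib_left using 1 2 3 by linarith
    then have "ennreal \<bar>R \<sigma> c\<bar> \<le> ennreal (216 * r * (norm (S0 ?y) + norm (grad_v f ?y) + r * \<sigma>\<^sup>2 * norm (S1 ?y)))"
      by (rule ennreal_leI)
    also have "\<dots> = b \<sigma> ?y"
      using r by (simp add: b_def ennreal_mult ennreal_plus)
    finally show ?thesis using True by simp
  qed
  have "ennreal \<bar>\<integral>c. (f (?T 1 z c) - f z) * bump c \<partial>lborel\<bar>
      \<le> (\<integral>\<^sup>+\<sigma>. ennreal \<bar>indicator {0..1} \<sigma> * (\<integral>c. H \<sigma> c * bump c \<partial>lborel)\<bar> \<partial>lborel)"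
    unfolding dev by (rule integral_norm_bound_nn)
  also have "\<dots> \<le> (\<integral>\<^sup>+\<sigma>. indicator {0..1} \<sigma> * (\<integral>\<^sup>+c. b \<sigma> (?T \<sigma> z c) * indicator ?B c \<partial>lborel) \<partial>lborel)"
  proof (rule nn_integral_mono_AE)
    show "AE \<sigma> in lborel. ennreal \<bar>indicator {0..1} \<sigma> * (\<integral>c. H \<sigma> c * bump c \<partial>lborel)\<bar>
        \<le> indicator {0..1} \<sigma> * (\<integral>\<^sup>+c. b \<sigma> (?T \<sigma> z c) * indicator ?B c \<partial>lborel)"
      using AE_lborel_singleton[of "0::real"]
    proof eventually_elim
      case (elim \<sigma>)
      show ?case
      proof (cases "\<sigma> \<in> {0..1}")
        case True
        then have s: "0 < \<sigma>" "\<sigma> \<le> 1" using elim by auto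
        have "ennreal \<bar>\<integral>c. R \<sigma> c \<partial>lborel\<bar> \<le> (\<integral>\<^sup>+c. ennreal \<bar>R \<sigma> c\<bar> \<partial>lborel)"
          by (rule integral_norm_bound_nn)
        also have "\<dots> \<le> (\<integral>\<^sup>+c. b \<sigma> (?T \<sigma> z c) * indicator ?B c \<partial>lborel)"
          using s by (intro nn_integral_mono Rb) auto
        finally show ?thesis using True by (simp add: HR[OF s(1)])
      qed simp
    qed
  qed
  also have "\<dots> = (\<integral>\<^sup>+\<sigma>. (\<integral>\<^sup>+c. b \<sigma> (?T \<sigma> z c) * indicator ?B c \<partial>lborel) \<partial>unit_interval)"
    by (rule nn_integral_unit_interval[symmetric]) (unfold b_def, measurable)
  finally show ?thesis unfolding b_def .
qed

text \<open>
  Average over \<open>\<tau>\<close> as well, which brings the estimate into the form of averages over all parameters.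
  
\<close>
lemma bump_average_deviation_traj_avg_le:
  fixes f S1 :: "'n::finite phase \<Rightarrow> real" and S0 :: "'n phase \<Rightarrow> real ^ 'n"
  assumes f: "f \<in> schwartz" and S0: "S0 \<in> schwartz" and S1: "S1 \<in> schwartz"
    and eq: "\<And>t x v. deriv_t f (t, x, v) + v \<bullet> grad_x f (t, x, v) = div_v S0 (t, x, v) + S1 (t, x, v)"
    and r: "r > 0" and k: "norm k \<le> 20 / 3"
  shows "(\<integral>\<^sup>+\<tau>\<in>{1..2}. ennreal \<bar>\<integral>c. (f (traj r k \<tau> 1 z c) - f z) * bump c \<partial>lborel\<bar> \<partial>lborel) \<le> ennreal (216 * r) *
    (traj_avg r k (\<lambda>_. 1) (\<lambda>y. ennreal (norm (S0 y))) z + traj_avg r k (\<lambda>_. 1) (\<lambda>y. ennreal (norm (grad_v f y))) z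
      + traj_avg r k (\<lambda>\<sigma>. ennreal (r * \<sigma>\<^sup>2)) (\<lambda>y. ennreal (norm (S1 y))) z)"
proof -
  let ?B = "cball 0 1 :: ((real ^ 'n) \<times> (real ^ 'n)) set"
  let ?P = "params :: (real \<times> (real ^ 'n) \<times> (real ^ 'n)) measure"
  have [measurable]: "f \<in> borel_measurable borel" "S0 \<in> borel_measurable borel" "S1 \<in> borel_measurable borel"
    "grad_v f \<in> borel_measurable borel" "?B \<in> sets borel"
    using schwartz_continuous[OF f] schwartz_continuous[OF S0] schwartz_continuous[OF S1] grad_v_continuous[OF f]
    by (auto intro: borel_measurable_continuous_onI)
  define b where "b \<sigma> y = ennreal (216 * r) * (ennreal (norm (S0 y)) + ennreal (norm (grad_v f y))
    + ennreal (r * \<sigma>\<^sup>2) * ennreal (norm (S1 y)))" for \<sigma> y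
  define I where "I \<tau> = ennreal \<bar>\<integral>c. (f (traj r k \<tau> 1 z c) - f z) * bump c \<partial>lborel\<bar>" for \<tau>
  interpret pair_sigma_finite lborel unit_interval ..
  have "(\<integral>\<^sup>+\<tau>\<in>{1..2}. I \<tau> \<partial>lborel)
      \<le> (\<integral>\<^sup>+\<tau>. (\<integral>\<^sup>+\<sigma>. (\<integral>\<^sup>+c\<in>?B. b \<sigma> (traj r k \<tau> \<sigma> z c) \<partial>lborel) * indicator {1..2} \<tau> \<partial>unit_interval) \<partial>lborel)"
  proof (intro nn_integral_mono)
    fix \<tau> :: real
    show "I \<tau> * indicator {1..2} \<tau>
        \<le> (\<integral>\<^sup>+\<sigma>. (\<integral>\<^sup>+c\<in>?B. b \<sigma> (traj r k \<tau> \<sigma> z c) \<partial>lborel) * indicator {1..2} \<tau> \<partial>unit_interval)"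
    proof (cases "\<tau> \<in> {1..2}")
      case True
      then have \<tau>: "1 \<le> \<tau>" "\<tau> \<le> 2" by auto
      have "I \<tau> \<le> (\<integral>\<^sup>+\<sigma>. (\<integral>\<^sup>+c\<in>?B. b \<sigma> (traj r k \<tau> \<sigma> z c) \<partial>lborel) \<partial>unit_interval)"
        unfolding I_def b_def by (rule bump_average_deviation_le[OF f S0 S1 eq r \<tau> k])
      then show ?thesis using True by simp
    qed simp
  qed
  also have "\<dots> = (\<integral>\<^sup>+\<sigma>. (\<integral>\<^sup>+\<tau>\<in>{1..2}. (\<integral>\<^sup>+c\<in>?B. b \<sigma> (traj r k \<tau> \<sigma> z c) \<partial>lborel) \<partial>lborel) \<partial>unit_interval)"
    unfolding b_def by (rule Fubini'[symmetric]) measurable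
  also have "\<dots> = (\<integral>\<^sup>+\<sigma>. (\<integral>\<^sup>+\<omega>. b \<sigma> (traj r k (fst \<omega>) \<sigma> z (snd \<omega>)) \<partial>?P) \<partial>unit_interval)"
  proof (rule nn_integral_cong)
    fix \<sigma> :: real
    have "(\<lambda>\<omega>. b \<sigma> (traj r k (fst \<omega>) \<sigma> z (snd \<omega>))) \<in> borel_measurable ?P"
      unfolding b_def by measurable
    then have "(\<lambda>\<omega>. b \<sigma> (traj r k (fst \<omega>) \<sigma> z (snd \<omega>))) \<in> borel_measurable borel"
      by (simp cong: measurable_cong_sets)
    from nn_integral_params[OF this]
    show "(\<integral>\<^sup>+\<tau>\<in>{1..2}. (\<integral>\<^sup>+c\<in>?B. b \<sigma> (traj r k \<tau> \<sigma> z c) \<partial>lborel) \<partial>lborel)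
        = (\<integral>\<^sup>+\<omega>. b \<sigma> (traj r k (fst \<omega>) \<sigma> z (snd \<omega>)) \<partial>?P)" by simp
  qed
  also have "\<dots> = ennreal (216 * r) *
    (traj_avg r k (\<lambda>_. 1) (\<lambda>y. ennreal (norm (S0 y))) z + traj_avg r k (\<lambda>_. 1) (\<lambda>y. ennreal (norm (grad_v f y))) z
      + traj_avg r k (\<lambda>\<sigma>. ennreal (r * \<sigma>\<^sup>2)) (\<lambda>y. ennreal (norm (S1 y))) z)"
    unfolding b_def traj_avg_def by (simp add: nn_integral_cmult nn_integral_add)
  finally show ?thesis unfolding I_def .
qed

text \<open>
  Both families of curves have the same endpoints, so the averages of \<open>f\<close> at the endpoints cancel and
  only the two deviations from the starting points remain, for every \<open>\<tau>\<close>.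
\<close>
lemma norm_diff_x_le_traj_avg:
  fixes f S1 :: "'n::finite phase \<Rightarrow> real" and S0 :: "'n phase \<Rightarrow> real ^ 'n"
  assumes f: "f \<in> schwartz" and S0: "S0 \<in> schwartz" and S1: "S1 \<in> schwartz"
    and eq: "\<And>t x v. deriv_t f (t, x, v) + v \<bullet> grad_x f (t, x, v) = div_v S0 (t, x, v) + S1 (t, x, v)"
    and r: "r > 0" "r ^ 3 = norm h" and k: "k = - (20 / (3 * r ^ 3)) *\<^sub>R h"
    and A: "\<And>k z. A k z = traj_avg r k (\<lambda>_. 1) (\<lambda>y. ennreal (norm (S0 y))) z
      + traj_avg r k (\<lambda>_. 1) (\<lambda>y. ennreal (norm (grad_v f y))) z
      + traj_avg r k (\<lambda>\<sigma>. ennreal (r * \<sigma>\<^sup>2)) (\<lambda>y. ennreal (norm (S1 y))) z"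
  shows "ennreal (\<integral>c. bump (c :: (real ^ 'n) \<times> (real ^ 'n)) \<partial>lborel) * ennreal (norm (diff_x h f z))
    \<le> ennreal (216 * r) * (A k ((0, h, 0) + z) + A 0 z)"
proof -
  let ?N = "\<integral>c. bump (c :: (real ^ 'n) \<times> (real ^ 'n)) \<partial>lborel"
  obtain t x v where z: "z = (t, x, v)" by (cases z)
  define zh where "zh = (t, x + h, v)"
  define I where "I k \<tau> z = (\<integral>c. (f (traj r k \<tau> 1 z c) - f z) * bump c \<partial>lborel)" for k \<tau> z
  have nk: "norm k \<le> 20 / 3"
  proof -
    have "norm k = 20 / (3 * norm h) * norm h" using r by (simp add: k)
    then show ?thesis using r by (cases "norm h = 0") auto
  qed
  have int: "integrable lborel (\<lambda>c. (f (traj r k \<tau> 1 z c) - a) * bump c)" for k \<tau> z a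
    by (intro integrable_bump_mult continuous_intros continuous_on_compose2[OF schwartz_continuous[OF f]]) auto
  have diff: "?N * diff_x h f z = I 0 \<tau> z - I k \<tau> zh" if "1 \<le> \<tau>" for \<tau>
  proof -
    have meet: "traj r k \<tau> 1 zh c = traj r 0 \<tau> 1 z c" for c
      unfolding k z zh_def using r that by (intro traj_meet) auto
    have "I 0 \<tau> z - I k \<tau> zh
        = (\<integral>c. (f (traj r 0 \<tau> 1 z c) - f z) * bump c - (f (traj r 0 \<tau> 1 z c) - f zh) * bump c \<partial>lborel)"
      unfolding I_def meet using int by simp
    also have "\<dots> = (\<integral>c. (f zh - f z) * bump (c :: (real ^ 'n) \<times> (real ^ 'n)) \<partial>lborel)"
      by (intro Bochner_Integration.integral_cong) (auto simp: algebra_simps)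
    finally show ?thesis by (simp add: z zh_def diff_x_def mult.commute)
  qed
  have N: "?N \<ge> 0" using integral_bump_pos[where 'a="(real ^ 'n) \<times> (real ^ 'n)"] by simp
  have "ennreal ?N * ennreal (norm (diff_x h f z)) \<le> ennreal \<bar>I k \<tau> zh\<bar> + ennreal \<bar>I 0 \<tau> z\<bar>" if "1 \<le> \<tau>" for \<tau>
  proof -
    have "?N * norm (diff_x h f z) = \<bar>?N * diff_x h f z\<bar>" using N by (simp add: abs_mult)
    also have "\<dots> \<le> \<bar>I k \<tau> zh\<bar> + \<bar>I 0 \<tau> z\<bar>" unfolding diff[OF that] by simp
    finally have "ennreal (?N * norm (diff_x h f z)) \<le> ennreal (\<bar>I k \<tau> zh\<bar> + \<bar>I 0 \<tau> z\<bar>)" by (rule ennreal_leI)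
    then show ?thesis using N by (simp add: ennreal_mult)
  qed
  then have "(\<integral>\<^sup>+\<tau>\<in>{1..2::real}. ennreal ?N * ennreal (norm (diff_x h f z)) \<partial>lborel)
      \<le> (\<integral>\<^sup>+\<tau>. ennreal \<bar>I k \<tau> zh\<bar> * indicator {1..2} \<tau> + ennreal \<bar>I 0 \<tau> z\<bar> * indicator {1..2} \<tau> \<partial>lborel)"
    by (intro nn_integral_mono) (auto split: split_indicator)
  also have "\<dots> = (\<integral>\<^sup>+\<tau>\<in>{1..2}. ennreal \<bar>I k \<tau> zh\<bar> \<partial>lborel) + (\<integral>\<^sup>+\<tau>\<in>{1..2}. ennreal \<bar>I 0 \<tau> z\<bar> \<partial>lborel)"
  proof (rule nn_integral_add)
    have [measurable]: "f \<in> borel_measurable borel" "(bump :: (real ^ 'n) \<times> (real ^ 'n) \<Rightarrow> real) \<in> borel_measurable borel"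
      using schwartz_continuous[OF f] by (auto intro!: borel_measurable_continuous_onI continuous_intros)
    show "(\<lambda>\<tau>. ennreal \<bar>I k \<tau> zh\<bar> * indicator {1..2} \<tau>) \<in> borel_measurable lborel"
      "(\<lambda>\<tau>. ennreal \<bar>I 0 \<tau> z\<bar> * indicator {1..2} \<tau>) \<in> borel_measurable lborel"
      unfolding I_def by measurable
  qed
  also have "\<dots> \<le> ennreal (216 * r) * A k zh + ennreal (216 * r) * A 0 z"
    unfolding A I_def using nk
    by (intro add_mono bump_average_deviation_traj_avg_le[OF f S0 S1 eq r(1)]) auto
  also have "\<dots> = ennreal (216 * r) * (A k ((0, h, 0) + z) + A 0 z)"
    by (simp add: distrib_left z zh_def add.commute)
  finally show ?thesis by (simp add: nn_integral_cmult)
qed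

section \<open>The estimate in Lebesgue spaces\<close>

lemma lborel_translation_invariant:
  "distr lborel lborel ((+) t) = (lborel :: 'a::euclidean_space measure)"
proof -
  have "lborel = density (distr lborel borel (\<lambda>x. t + 1 *\<^sub>R x)) (\<lambda>_. ennreal (\<bar>1\<bar> ^ DIM('a)))"
    by (rule lborel_affine) simp
  then have "lborel = distr lborel borel ((+) t)" by (simp add: density_1)
  also have "\<dots> = distr lborel lborel ((+) t)" by (rule distr_cong) auto
  finally show ?thesis ..
qed

text \<open>
  The pointwise bound combined with the \<open>L\<^sup>p\<close> bounds for averages.  The numerical constant is
  \<open>216 \<cdot> 128\<close>: a factor \<open>4\<close> for each of the three nested uses of \<open>eLp_add\<close>, and \<open>2\<close> for the two starting
  points.
\<close>
lemma eLp_diff_x_le: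
  fixes f S1 :: "'n::finite phase \<Rightarrow> real" and S0 :: "'n phase \<Rightarrow> real ^ 'n" and Q q :: real
  assumes f: "f \<in> schwartz" and S0: "S0 \<in> schwartz" and S1: "S1 \<in> schwartz"
    and eq: "\<And>t x v. deriv_t f (t, x, v) + v \<bullet> grad_x f (t, x, v) = div_v S0 (t, x, v) + S1 (t, x, v)"
    and r: "r > 0" "r ^ 3 = norm h"
    and p: "1 \<le> p" and q: "1 \<le> q" and Q: "Q = 4 * real CARD('n) + 2"
    and pq: "1 / ennreal q = 1 / p + 1 / ennreal Q"
    and N: "N = (\<integral>c. bump (c :: (real ^ 'n) \<times> (real ^ 'n)) \<partial>lborel)"
    and M: "M = emeasure (params :: (real \<times> (real ^ 'n) \<times> (real ^ 'n)) measure) UNIV"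
  shows "eLp p lborel (\<lambda>z. ennreal (norm (diff_x h f z)))
    \<le> ennreal (27648 * r / N) * (M + ennreal (20 / 3) * M epowr (1 - 1 / Q)) *
      (eLp p lborel (\<lambda>z. ennreal (norm (S0 z))) + eLp p lborel (\<lambda>z. ennreal (norm (grad_v f z)))
       + eLp (ennreal q) lborel (\<lambda>z. ennreal (norm (S1 z))))"
proof -
  define k where "k = - (20 / (3 * r ^ 3)) *\<^sub>R h"
  let ?g0 = "\<lambda>y. ennreal (norm (S0 y))" and ?gf = "\<lambda>y. ennreal (norm (grad_v f y))" and ?g1 = "\<lambda>y. ennreal (norm (S1 y))"
  define A where "A k z = traj_avg r k (\<lambda>_. 1) ?g0 z + traj_avg r k (\<lambda>_. 1) ?gf z
      + traj_avg r k (\<lambda>\<sigma>. ennreal (r * \<sigma>\<^sup>2)) ?g1 z" for k z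
  let ?X = "eLp p lborel ?g0 + eLp p lborel ?gf + eLp (ennreal q) lborel ?g1"
  define K where "K = M + ennreal (20 / 3) * M epowr (1 - 1 / Q)"
  note cont = schwartz_continuous[OF f] schwartz_continuous[OF S0] schwartz_continuous[OF S1] grad_v_continuous[OF f]
  have [measurable]: "f \<in> borel_measurable borel" "S0 \<in> borel_measurable borel" "S1 \<in> borel_measurable borel"
    "grad_v f \<in> borel_measurable borel"
    using cont by (auto intro: borel_measurable_continuous_onI)
  have A_meas [measurable]: "A k \<in> borel_measurable borel" for k
    unfolding A_def[abs_def] by measurable
  have N0: "N > 0" unfolding N by (rule integral_bump_pos)
  have A_le: "eLp p lborel (A k) \<le> 16 * (K * ?X)" for k
  proof -
    have K: "M \<le> K" "ennreal (20 / 3) * M epowr (1 - 1 / Q) \<le> K" by (simp_all add: K_def)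
    have same: "eLp p lborel (traj_avg r k (\<lambda>_. 1) (\<lambda>y. ennreal (norm (g y)))) \<le> K * eLp p lborel (\<lambda>y. ennreal (norm (g y)))"
      if "continuous_on UNIV g" for g :: "'n phase \<Rightarrow> real ^ 'n"
      using eLp_traj_avg_same_exponent[OF p continuous_on_norm[OF that], folded M] mult_right_mono[OF K(1)]
      by (rule order_trans) simp
    have "eLp p lborel (traj_avg r k (\<lambda>_. 1) ?g0) \<le> K * eLp p lborel ?g0"
      "eLp p lborel (traj_avg r k (\<lambda>_. 1) ?gf) \<le> K * eLp p lborel ?gf"
      using cont by (auto intro: same)
    moreover have "eLp p lborel (traj_avg r k (\<lambda>\<sigma>. ennreal (r * \<sigma>\<^sup>2)) ?g1) \<le> K * eLp (ennreal q) lborel ?g1"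
    proof -
      have "?g1 \<in> borel_measurable borel" by measurable
      from eLp_traj_avg_gain[OF this r(1) p q Q pq, folded M] mult_right_mono[OF K(2)]
      show ?thesis by (rule order_trans) simp
    qed
    moreover have "eLp p lborel (A k) \<le> 4 * (4 * (eLp p lborel (traj_avg r k (\<lambda>_. 1) ?g0)
        + eLp p lborel (traj_avg r k (\<lambda>_. 1) ?gf)) + 4 * eLp p lborel (traj_avg r k (\<lambda>\<sigma>. ennreal (r * \<sigma>\<^sup>2)) ?g1))"
    proof -
      have le4: "a \<le> 4 * a" for a :: ennreal
        using mult_right_mono[of 1 4 a] by simp
      have "eLp p lborel (A k) \<le> 4 * (eLp p lborel (\<lambda>z. traj_avg r k (\<lambda>_. 1) ?g0 z + traj_avg r k (\<lambda>_. 1) ?gf z)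
          + eLp p lborel (traj_avg r k (\<lambda>\<sigma>. ennreal (r * \<sigma>\<^sup>2)) ?g1))"
        unfolding A_def[abs_def] using p by (intro eLp_add) measurable
      also have "\<dots> \<le> 4 * (4 * (eLp p lborel (traj_avg r k (\<lambda>_. 1) ?g0)
        + eLp p lborel (traj_avg r k (\<lambda>_. 1) ?gf)) + 4 * eLp p lborel (traj_avg r k (\<lambda>\<sigma>. ennreal (r * \<sigma>\<^sup>2)) ?g1))"
        using p by (intro mult_left_mono add_mono eLp_add le4) auto
      finally show ?thesis .
    qed
    ultimately have "eLp p lborel (A k) \<le> 4 * (4 * (K * eLp p lborel ?g0 + K * eLp p lborel ?gf) + 4 * (K * eLp (ennreal q) lborel ?g1))"
      by (elim order_trans) (intro mult_left_mono add_mono; simp)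
    also have "\<dots> = (4 * 4) * (K * ?X)" by (simp only: distrib_left mult.assoc)
    finally show ?thesis by simp
  qed
  have pt: "ennreal (norm (diff_x h f z)) \<le> ennreal (216 * r / N) * (A k ((0, h, 0) + z) + A 0 z)" for z
  proof -
    have "ennreal N * ennreal (norm (diff_x h f z)) \<le> ennreal (216 * r) * (A k ((0, h, 0) + z) + A 0 z)"
      unfolding N by (rule norm_diff_x_le_traj_avg[OF f S0 S1 eq r k_def A_def])
    then have "ennreal (1 / N) * (ennreal N * ennreal (norm (diff_x h f z)))
        \<le> ennreal (1 / N) * (ennreal (216 * r) * (A k ((0, h, 0) + z) + A 0 z))"
      by (rule mult_left_mono) simp
    then show ?thesis
      using N0 r by (simp add: mult.assoc[symmetric] ennreal_mult[symmetric])
  qed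
  have [measurable]: "diff_x h f \<in> borel_measurable borel"
  proof -
    have "diff_x h f = (\<lambda>z. f (z + (0, h, 0)) - f z)" by (auto simp: diff_x_def fun_eq_iff)
    then show ?thesis by simp
  qed
  have "eLp p lborel (\<lambda>z. ennreal (norm (diff_x h f z)))
      \<le> eLp p lborel (\<lambda>z. ennreal (216 * r / N) * (A k ((0, h, 0) + z) + A 0 z))"
    using pt by (intro eLp_mono) auto
  also have "\<dots> \<le> ennreal (216 * r / N) * eLp p lborel (\<lambda>z. A k ((0, h, 0) + z) + A 0 z)"
    using p r N0 by (intro eLp_cmult) auto
  also have "eLp p lborel (\<lambda>z. A k ((0, h, 0) + z) + A 0 z) \<le> 4 * (eLp p lborel (\<lambda>z. A k ((0, h, 0) + z)) + eLp p lborel (A 0))"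
    using p by (intro eLp_add) auto
  also have "eLp p lborel (\<lambda>z. A k ((0, h, 0) + z)) \<le> eLp p lborel (A k)"
    using p by (intro eLp_measure_preserving) (auto simp: lborel_translation_invariant)
  also have "4 * (eLp p lborel (A k) + eLp p lborel (A 0)) \<le> 4 * (16 * (K * ?X) + 16 * (K * ?X))"
    by (intro mult_left_mono add_mono A_le) auto
  also have "\<dots> = 128 * (K * ?X)"
  proof -
    have "4 * (16 * a + 16 * a) = 128 * a" for a :: ennreal
      by (simp add: distrib_right[symmetric] mult.assoc[symmetric])
    then show ?thesis .
  qed
  finally have "eLp p lborel (\<lambda>z. ennreal (norm (diff_x h f z))) \<le> ennreal (216 * r / N) * (128 * (K * ?X))"
    by (simp add: mult_left_mono add_right_mono)
  also have "ennreal (216 * r / N) * (128 * (K * ?X)) = ennreal (27648 * r / N) * K * ?X"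
  proof -
    have "ennreal (27648 * r / N) = ennreal (216 * r / N) * ennreal 128"
      using r N0 by (subst ennreal_mult[symmetric]) auto
    moreover have "a * (128 * (K * x)) = a * ennreal 128 * K * x" for a x :: ennreal
      by (simp add: mult_ac)
    ultimately show ?thesis by simp
  qed
  finally show ?thesis unfolding K_def .
qed

theorem theorem3p1:
  fixes Q :: real and p q :: ennreal
  assumes "Q = 4 * real CARD('n::finite) + 2"
    and "p \<in> {ennreal (Q / (Q - 1))..\<infinity>}"
    and "q \<in> {1..\<infinity>}"
    and "1 / q = 1 / p + 1 / ennreal Q"
  shows "\<exists>C::real. C > 0 \<and>
    (\<forall>(f :: 'n phase \<Rightarrow> real) (S0 :: 'n phase \<Rightarrow> real ^ 'n) (S1 :: 'n phase \<Rightarrow> real).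
       f \<in> schwartz \<inter> Lp_space p lborel \<longrightarrow>
       grad_v f \<in> Lp_space p lborel \<longrightarrow>
       S0 \<in> schwartz \<inter> Lp_space p lborel \<longrightarrow>
       S1 \<in> schwartz \<inter> Lp_space q lborel \<longrightarrow>
       (\<forall>t x v. deriv_t f (t, x, v) + v \<bullet> grad_x f (t, x, v)
                  = div_v S0 (t, x, v) + S1 (t, x, v)) \<longrightarrow>
       (SUP h\<in>UNIV - {0}. Lp_norm p lborel (diff_x h f) / ennreal (norm h powr (1/3)))
         \<le> ennreal C * (Lp_norm p lborel S0 + Lp_norm p lborel (grad_v f) + Lp_norm q lborel S1))"
proof -
  have Q0: "Q > 1" using assms(1) by simp
  have p: "1 \<le> p"
  proof -
    have "ennreal 1 \<le> ennreal (Q / (Q - 1))" using Q0 by (intro ennreal_leI) simp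
    also have "\<dots> \<le> p" using assms(2) by simp
    finally show ?thesis by simp
  qed
  have "q \<noteq> \<infinity>"
  proof
    assume "q = \<infinity>"
    then have "1 / ennreal Q = 0" using assms(4) by simp
    then show False using Q0 by (simp add: ennreal_1[symmetric] divide_ennreal del: ennreal_1)
  qed
  moreover have "1 \<le> q" using assms(3) by simp
  ultimately obtain q' where q: "1 \<le> q'" "q = ennreal q'" by (auto elim: exponent_cases)
  define N where "N = (\<integral>c. bump (c :: (real ^ 'n) \<times> (real ^ 'n)) \<partial>lborel)"
  define M where "M = emeasure (params :: (real \<times> (real ^ 'n) \<times> (real ^ 'n)) measure) UNIV"
  define K where "K = M + ennreal (20 / 3) * M epowr (1 - 1 / Q)"
  have N: "N > 0" unfolding N_def by (rule integral_bump_pos)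
  have "M \<noteq> \<infinity>"
    using params.emeasure_finite[of UNIV] by (simp add: M_def)
  then have "K < \<infinity>" by (auto simp: K_def ennreal_mult_eq_top_iff less_top[symmetric])
  then obtain K' where K': "K' \<ge> 0" "K = ennreal K'" by (cases K) auto
  \<comment> \<open>The summand \<open>1\<close> makes positivity of \<open>C\<close> immediate.\<close>
  define C where "C = 27648 / N * K' + 1"
  have C: "C > 0" using N K' by (simp add: C_def add_nonneg_pos)
  have "(SUP h\<in>UNIV - {0}. Lp_norm p lborel (diff_x h f) / ennreal (norm h powr (1/3)))
         \<le> ennreal C * (Lp_norm p lborel S0 + Lp_norm p lborel (grad_v f) + Lp_norm q lborel S1)"
    if f: "f \<in> schwartz" and S0: "S0 \<in> schwartz" and S1: "S1 \<in> schwartz"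
      and eq: "\<And>t x v. deriv_t f (t, x, v) + v \<bullet> grad_x f (t, x, v) = div_v S0 (t, x, v) + S1 (t, x, v)"
    for f S1 :: "'n phase \<Rightarrow> real" and S0 :: "'n phase \<Rightarrow> real ^ 'n"
  proof (rule SUP_least)
    let ?X = "Lp_norm p lborel S0 + Lp_norm p lborel (grad_v f) + Lp_norm q lborel S1"
    fix h :: "real ^ 'n" assume "h \<in> UNIV - {0}"
    then have h: "norm h > 0" by simp
    define r where "r = norm h powr (1/3)"
    have r: "r > 0" "r ^ 3 = norm h"
      using h by (auto simp: r_def powr_realpow[symmetric] powr_powr)
    have "Lp_norm p lborel (diff_x h f) \<le> ennreal (27648 * r / N) * K * ?X"
      unfolding Lp_norm_eq_eLp q(2) K_def
      by (rule eLp_diff_x_le[OF f S0 S1 eq r p q(1) assms(1) assms(4)[unfolded q(2)] N_def M_def])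
    also have "ennreal (27648 * r / N) * K = ennreal (27648 / N * K') * ennreal r"
      using r N K' by (simp add: ennreal_mult[symmetric] mult_ac)
    also have "\<dots> * ?X \<le> ennreal C * ennreal r * ?X"
      by (intro mult_right_mono ennreal_leI) (auto simp: C_def)
    also have "\<dots> = ennreal C * ?X * ennreal r" by (simp add: mult_ac)
    finally have "Lp_norm p lborel (diff_x h f) / ennreal r \<le> ennreal C * ?X * ennreal r / ennreal r"
      by (rule divide_right_mono_ennreal)
    also have "\<dots> = ennreal C * ?X"
      using r by (subst mult_divide_eq_ennreal) auto
    finally show "Lp_norm p lborel (diff_x h f) / ennreal (norm h powr (1/3)) \<le> ennreal C * ?X"
      by (simp add: r_def)
  qed
  with C show ?thesis by blast
qed

end
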